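(* Fix $\tau>0$. There is a unique $\mathrm{SO}(3)$-equivariant unitary $$\mathcal{T}_\tau\colon H^2(\partial M_\tau)\longrightarrow H^2(Y)$$ that sends $v\otimes\widehat w_\ell(\tau)$ to $v\otimes\widehat u_\ell$ for every $\ell\in\mathbb{N}_0$ and every $v\in V_\ell$. Its extension by zero (on the orthogonal complement of $H^2(\partial M_\tau)$) to $L^2(\mathrm{SO}(3))$ is a partial isometry and has block formula $$\mathcal{T}_\tau\big|_{V_\ell\otimes V_\ell^*}=\mathrm{Id}_{V_\ell}\otimes|\widehat u_\ell\rangle\langle\widehat w_\ell(\tau)| .$$
   Context: The Peter--Weyl decomposition is $L^2(\mathrm{SO}(3))\simeq\bigoplus_{\ell\ge0}V_\ell\otimes V_\ell^*$ (normalized Haar measure), with $V_\ell$ the irreducible unitary $\mathrm{SO}(3)$ representation of dimension $2\ell+1$; the left regular action of $\mathrm{SO}(3)$ acts on the first factor, and equivariance refers to this action. Via a fixed equivariant unitary identification, $V_\ell^*\simeq V_\ell\simeq\mathrm{Sym}^{2\ell}\mathbb{C}^2$, the homogeneous polynomials of degree $2\ell$ in $(z_0,z_1)$, with the invariant inner product for which monomials are orthogonal and $\|z_0^{2\ell-k}z_1^k\|^2=\binom{2\ell}{k}^{-1}$. Put $$u_\ell=z_0^{2\ell},\qquad w_\ell(\tau)=(z_0^2+z_1^2+2\coth\tau\,z_0z_1)^\ell,\qquad \widehat v=v/\|v\|.$$ $H^2(Y)$ (the Hardy space of the unit circle bundle $Y$ of $\mathcal{O}(-2)\to\mathbb{CP}^1$)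 and $H^2(\partial M_\tau)$ (the Hardy space of the boundary of the radius-$\tau$ Grauert tube of the round $\mathbb{S}^2$) are realized in $L^2(\mathrm{SO}(3))$ as the Hilbert direct sums $$H^2(Y)=\widehat{\bigoplus_{\ell\ge0}}V_\ell\otimes\mathbb{C}u_\ell,\qquad H^2(\partial M_\tau)=\widehat{\bigoplus_{\ell\ge0}}V_\ell\otimes\mathbb{C}w_\ell(\tau).$$ $|a\rangle\langle b|$ denotes the rank-one operator $x\mapsto\langle x,b\rangle a$, with inner products linear in the first variable. *)

theory Defs
  imports "HOL-Analysis.Analysis" "HOL-Probability.Probability_Measure"
begin

section \<open>The group SO(3), its Haar measure and its double cover by SU(2)\<close>

definition SO3 :: "(real^3^3) set" where
  "SO3 = {R. orthogonal_matrix R \<and> det R = 1}"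

definition is_haar_SO3 :: "(real^3^3) measure \<Rightarrow> bool" where
  "is_haar_SO3 \<mu> \<longleftrightarrow> sets \<mu> = sets (restrict_space borel SO3) \<and> prob_space \<mu> \<and>
     (\<forall>R\<in>SO3. \<forall>B\<in>sets \<mu>. emeasure \<mu> ((\<lambda>g. R ** g) ` B) = emeasure \<mu> B)"

text \<open>The normalized Haar measure is the unique left-invariant Borel probability measure.\<close>

definition haar_SO3 :: "(real^3^3) measure" where
  "haar_SO3 = (THE \<mu>. is_haar_SO3 \<mu>)"

definition adjoint_matrix :: "complex^2^2 \<Rightarrow> complex^2^2" where
  "adjoint_matrix A = (\<chi> i j. cnj (A $ j $ i))"

definition SU2 :: "(complex^2^2) set" where
  "SU2 = {A. A ** adjoint_matrix A = mat 1 \<and> det A = 1}"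

definition pauli :: "real^3 \<Rightarrow> complex^2^2" where
  "pauli x = vector [vector [of_real (x$3), Complex (x$1) (- (x$2))],
                     vector [Complex (x$1) (x$2), - of_real (x$3)]]"

text \<open>\<open>covers A R\<close>: the double cover SU(2) \<open>\<rightarrow>\<close> SO(3), given by conjugation on traceless
  Hermitian matrices, sends \<open>A\<close> to \<open>R\<close>.\<close>

definition covers :: "complex^2^2 \<Rightarrow> real^3^3 \<Rightarrow> bool" where
  "covers A R \<longleftrightarrow> (\<forall>x. A ** pauli x ** adjoint_matrix A = pauli (R *v x))"


section \<open>The Hilbert space \<open>L\<^sup>2(SO(3))\<close>\<close>

definition sq_integrable :: "(real^3^3 \<Rightarrow> complex) \<Rightarrow> bool" where
  "sq_integrable f \<longleftrightarrow>
     f \<in> borel_measurable haar_SO3 \<and> integrable haar_SO3 (\<lambda>g. (cmod (f g))\<^sup>2)"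

definition l2_rel :: "(real^3^3 \<Rightarrow> complex) \<Rightarrow> (real^3^3 \<Rightarrow> complex) \<Rightarrow> bool" where
  "l2_rel f h \<longleftrightarrow> sq_integrable f \<and> sq_integrable h \<and> (AE g in haar_SO3. f g = h g)"

lemma sq_integrable_zero: "sq_integrable (\<lambda>_. 0)"
  by (simp add: sq_integrable_def)

lemma sq_integrable_cmult: "sq_integrable f \<Longrightarrow> sq_integrable (\<lambda>g. c * f g)"
  by (auto simp: sq_integrable_def norm_mult power_mult_distrib)

lemma sq_integrable_add:
  assumes "sq_integrable f" "sq_integrable h"
  shows "sq_integrable (\<lambda>g. f g + h g)"
proof -
  have m [measurable]: "f \<in> borel_measurable haar_SO3" "h \<in> borel_measurable haar_SO3"
    using assms by (auto simp: sq_integrable_def)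
  have le: "(cmod (a + b))\<^sup>2 \<le> 2 * (cmod a)\<^sup>2 + 2 * (cmod b)\<^sup>2" for a b
  proof -
    have "(cmod (a + b))\<^sup>2 \<le> (cmod a + cmod b)\<^sup>2"
      by (intro power_mono norm_triangle_ineq) auto
    also have "\<dots> \<le> 2 * (cmod a)\<^sup>2 + 2 * (cmod b)\<^sup>2"
      using sum_squares_bound[of "cmod a" "cmod b"] by (simp add: power2_sum)
    finally show ?thesis .
  qed
  have "integrable haar_SO3 (\<lambda>g. (cmod (f g + h g))\<^sup>2)"
  proof (rule Bochner_Integration.integrable_bound)
    show "integrable haar_SO3 (\<lambda>g. 2 * (cmod (f g))\<^sup>2 + 2 * (cmod (h g))\<^sup>2)"
      using assms by (auto simp: sq_integrable_def)
  qed (auto intro!: AE_I2 le)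
  then show ?thesis by (simp add: sq_integrable_def)
qed

quotient_type l2 = "real^3^3 \<Rightarrow> complex" / partial: l2_rel
proof (rule part_equivpI)
  show "\<exists>f. l2_rel f f"
    using sq_integrable_zero by (auto simp: l2_rel_def)
  show "symp l2_rel"
    by (auto simp: symp_def l2_rel_def)
  show "transp l2_rel"
    by (auto simp: transp_def l2_rel_def)
qed

instantiation l2 :: ab_group_add
begin

lift_definition zero_l2 :: l2 is "\<lambda>_. 0"
  by (simp add: l2_rel_def sq_integrable_zero)

lift_definition plus_l2 :: "l2 \<Rightarrow> l2 \<Rightarrow> l2" is "\<lambda>f h g. f g + h g"
  by (auto simp: l2_rel_def sq_integrable_add)

lift_definition uminus_l2 :: "l2 \<Rightarrow> l2" is "\<lambda>f g. - f g"
  using sq_integrable_cmult[of _ "-1"] by (auto simp: l2_rel_def)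

definition minus_l2 :: "l2 \<Rightarrow> l2 \<Rightarrow> l2" where
  "minus_l2 F H = F + (- H)"

instance
proof
  fix a b c :: l2
  show "a + b + c = a + (b + c)"
    by transfer (auto simp: l2_rel_def add.assoc intro!: sq_integrable_add)
  show "a + b = b + a"
    by transfer (auto simp: l2_rel_def add.commute intro!: sq_integrable_add)
  show "0 + a = a"
    by transfer (auto simp: l2_rel_def)
  show "- a + a = 0"
    by transfer (auto simp: l2_rel_def sq_integrable_zero)
  show "a - b = a + - b"
    by (rule minus_l2_def)
qed

end

lift_definition l2_scale :: "complex \<Rightarrow> l2 \<Rightarrow> l2" is "\<lambda>c f g. c * f g"
  by (auto simp: l2_rel_def sq_integrable_cmult)

lift_definition l2_inner :: "l2 \<Rightarrow> l2 \<Rightarrow> complex"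
  is "\<lambda>f h. LINT g|haar_SO3. f g * cnj (h g)"
proof -
  fix f f' h h' assume *: "l2_rel f f'" "l2_rel h h'"
  then have [measurable]: "f \<in> borel_measurable haar_SO3" "f' \<in> borel_measurable haar_SO3"
      "h \<in> borel_measurable haar_SO3" "h' \<in> borel_measurable haar_SO3"
    by (auto simp: l2_rel_def sq_integrable_def)
  have [measurable]: "cnj \<in> borel_measurable borel"
    by (intro borel_measurable_continuous_onI continuous_intros)
  show "(LINT g|haar_SO3. f g * cnj (h g)) = (LINT g|haar_SO3. f' g * cnj (h' g))"
    by (rule integral_cong_AE) (use * in \<open>auto simp: l2_rel_def\<close>)
qed

definition l2_norm :: "l2 \<Rightarrow> real" where
  "l2_norm F = sqrt (Re (l2_inner F F))"

text \<open>Left regular action \<open>(R \<cdot> f)(g) = f(R\<inverse> g)\<close>; by invariance of the Haar measure the class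
  does not depend on the chosen representative \<open>rep_l2 F\<close>.\<close>

definition left_translate :: "real^3^3 \<Rightarrow> l2 \<Rightarrow> l2" where
  "left_translate R F = abs_l2 (\<lambda>g. rep_l2 F (matrix_inv R ** g))"


section \<open>Homogeneous polynomials in \<open>(z\<^sub>0, z\<^sub>1)\<close>\<close>

text \<open>Polynomials are identified with polynomial functions on \<open>\<complex>\<^sup>2\<close>; the variables
  \<open>z\<^sub>0, z\<^sub>1\<close> are \<open>z $ 1, z $ 2\<close>.\<close>

type_synonym cpoly2 = "complex^2 \<Rightarrow> complex"

definition mon :: "nat \<Rightarrow> nat \<Rightarrow> cpoly2" where
  "mon n k = (\<lambda>z. (z $ 1) ^ (n - k) * (z $ 2) ^ k)"

definition hom_poly :: "nat \<Rightarrow> (nat \<Rightarrow> complex) \<Rightarrow> cpoly2" where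
  "hom_poly n c = (\<lambda>z. \<Sum>k\<le>n. c k * mon n k z)"

definition Sym :: "nat \<Rightarrow> cpoly2 set" where
  "Sym n = range (hom_poly n)"

definition hom_coeff :: "nat \<Rightarrow> cpoly2 \<Rightarrow> nat \<Rightarrow> complex" where
  "hom_coeff n p = (THE c. (\<forall>k>n. c k = 0) \<and> p = hom_poly n c)"

text \<open>The invariant inner product: monomials are orthogonal and
  \<open>\<parallel>mon n k\<parallel>\<^sup>2 = 1 / (n choose k)\<close>.\<close>

definition sym_inner :: "nat \<Rightarrow> cpoly2 \<Rightarrow> cpoly2 \<Rightarrow> complex" where
  "sym_inner n p q =
     (\<Sum>k\<le>n. hom_coeff n p k * cnj (hom_coeff n q k) / of_nat (n choose k))"

definition sym_norm :: "nat \<Rightarrow> cpoly2 \<Rightarrow> real" where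
  "sym_norm n p = sqrt (Re (sym_inner n p p))"

definition normalized :: "nat \<Rightarrow> cpoly2 \<Rightarrow> cpoly2" where
  "normalized n p = (\<lambda>z. p z / of_real (sym_norm n p))"

definition rank_one :: "nat \<Rightarrow> cpoly2 \<Rightarrow> cpoly2 \<Rightarrow> cpoly2 \<Rightarrow> cpoly2" where
  "rank_one n a b x = (\<lambda>z. sym_inner n x b * a z)"

text \<open>The irreducible representation of SO(3) on \<open>Sym (2 * l)\<close>: an element \<open>A\<close> of SU(2) acts by
  \<open>p \<mapsto> p \<circ> A\<inverse>\<close>. The two lifts of \<open>R\<close> are \<open>\<plusminus>A\<close> and give the same operator because the
  degree is even.\<close>

definition so3_rep :: "real^3^3 \<Rightarrow> cpoly2 \<Rightarrow> cpoly2" where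
  "so3_rep R p = (let A = (SOME A. A \<in> SU2 \<and> covers A R) in (\<lambda>z. p (matrix_inv A *v z)))"

definition u_vec :: "nat \<Rightarrow> cpoly2" where
  "u_vec l = (\<lambda>z. (z $ 1) ^ (2 * l))"

definition coth :: "real \<Rightarrow> real" where
  "coth t = cosh t / sinh t"

definition w_vec :: "real \<Rightarrow> nat \<Rightarrow> cpoly2" where
  "w_vec \<tau> l = (\<lambda>z. ((z $ 1)\<^sup>2 + (z $ 2)\<^sup>2 + 2 * of_real (coth \<tau>) * (z $ 1) * (z $ 2)) ^ l)"


section \<open>Tensor products and the Hilbert direct sum\<close>

text \<open>\<open>V\<^sub>l \<otimes> V\<^sub>l\<^sup>*\<close>, with both factors identified with \<open>Sym (2 * l)\<close>, is the space of
  bihomogeneous polynomials \<open>X z z'\<close>, where \<open>(v \<otimes> \<xi>) z z' = v z * \<xi> z'\<close>. The first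
  argument belongs to the first tensor factor.\<close>

type_synonym cpoly22 = "complex^2 \<Rightarrow> complex^2 \<Rightarrow> complex"

definition tensor :: "cpoly2 \<Rightarrow> cpoly2 \<Rightarrow> cpoly22" where
  "tensor v \<xi> = (\<lambda>z z'. v z * \<xi> z')"

definition Sym_tensor :: "nat \<Rightarrow> cpoly22 set" where
  "Sym_tensor n = {X. \<exists>m v \<xi>. (\<forall>i<m. v i \<in> Sym n \<and> \<xi> i \<in> Sym n) \<and>
     X = (\<lambda>z z'. \<Sum>i<(m::nat). tensor (v i) (\<xi> i) z z')}"

definition tensor_coeff :: "nat \<Rightarrow> cpoly22 \<Rightarrow> nat \<Rightarrow> nat \<Rightarrow> complex" where
  "tensor_coeff n X j k = hom_coeff n (\<lambda>z. hom_coeff n (X z) k) j"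

text \<open>The tensor product inner product, that is, the sesquilinear form with
  \<open>\<langle>v \<otimes> \<xi>, v' \<otimes> \<xi>'\<rangle> = \<langle>v, v'\<rangle> \<langle>\<xi>, \<xi>'\<rangle>\<close>.\<close>

definition tensor_inner :: "nat \<Rightarrow> cpoly22 \<Rightarrow> cpoly22 \<Rightarrow> complex" where
  "tensor_inner n X Y = (\<Sum>j\<le>n. \<Sum>k\<le>n. tensor_coeff n X j k * cnj (tensor_coeff n Y j k)
     / (of_nat (n choose j) * of_nat (n choose k)))"

definition op_tensor_id :: "(cpoly2 \<Rightarrow> cpoly2) \<Rightarrow> cpoly22 \<Rightarrow> cpoly22" where
  "op_tensor_id B X = (\<lambda>z z'. B (\<lambda>y. X y z') z)"

definition id_tensor_op :: "(cpoly2 \<Rightarrow> cpoly2) \<Rightarrow> cpoly22 \<Rightarrow> cpoly22" where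
  "id_tensor_op B X = (\<lambda>z z'. B (X z) z')"

definition PW :: "(nat \<Rightarrow> cpoly22) set" where
  "PW = {X. (\<forall>l. X l \<in> Sym_tensor (2 * l)) \<and>
     summable (\<lambda>l. Re (tensor_inner (2 * l) (X l) (X l)))}"

definition PW_inner :: "(nat \<Rightarrow> cpoly22) \<Rightarrow> (nat \<Rightarrow> cpoly22) \<Rightarrow> complex" where
  "PW_inner X Y = (\<Sum>l. tensor_inner (2 * l) (X l) (Y l))"

definition block :: "nat \<Rightarrow> cpoly22 \<Rightarrow> nat \<Rightarrow> cpoly22" where
  "block l X = (\<lambda>m. if m = l then X else (\<lambda>z z'. 0))"

text \<open>A Peter--Weyl identification is a unitary map from the Hilbert direct sum of the
  \<open>V\<^sub>l \<otimes> V\<^sub>l\<^sup>*\<close> onto \<open>L\<^sup>2(SO(3))\<close> under which the left regular action is the action on the first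
  factors.\<close>

definition peter_weyl :: "((nat \<Rightarrow> cpoly22) \<Rightarrow> l2) \<Rightarrow> bool" where
  "peter_weyl \<Phi> \<longleftrightarrow>
     bij_betw \<Phi> PW UNIV \<and>
     (\<forall>X\<in>PW. \<forall>Y\<in>PW. \<Phi> (\<lambda>l z z'. X l z z' + Y l z z') = \<Phi> X + \<Phi> Y) \<and>
     (\<forall>c. \<forall>X\<in>PW. \<Phi> (\<lambda>l z z'. c * X l z z') = l2_scale c (\<Phi> X)) \<and>
     (\<forall>X\<in>PW. \<forall>Y\<in>PW. l2_inner (\<Phi> X) (\<Phi> Y) = PW_inner X Y) \<and>
     (\<forall>R\<in>SO3. \<forall>X\<in>PW.
        \<Phi> (\<lambda>l. op_tensor_id (so3_rep R) (X l)) = left_translate R (\<Phi> X))"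

text \<open>The Hilbert direct sum of the \<open>V\<^sub>l \<otimes> \<complex> a\<^sub>l\<close> inside \<open>L\<^sup>2(SO(3))\<close>.\<close>

definition hilbert_sum_line ::
    "((nat \<Rightarrow> cpoly22) \<Rightarrow> l2) \<Rightarrow> (nat \<Rightarrow> cpoly2) \<Rightarrow> l2 set" where
  "hilbert_sum_line \<Phi> a =
     \<Phi> ` {X \<in> PW. \<forall>l. \<exists>v\<in>Sym (2 * l). X l = tensor v (a l)}"

definition hardy_Y :: "((nat \<Rightarrow> cpoly22) \<Rightarrow> l2) \<Rightarrow> l2 set" where
  "hardy_Y \<Phi> = hilbert_sum_line \<Phi> u_vec"

definition hardy_M :: "((nat \<Rightarrow> cpoly22) \<Rightarrow> l2) \<Rightarrow> real \<Rightarrow> l2 set" where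
  "hardy_M \<Phi> \<tau> = hilbert_sum_line \<Phi> (w_vec \<tau>)"


section \<open>Operators on \<open>L\<^sup>2(SO(3))\<close>\<close>

definition clinear_on :: "l2 set \<Rightarrow> (l2 \<Rightarrow> l2) \<Rightarrow> bool" where
  "clinear_on S T \<longleftrightarrow> (\<forall>F\<in>S. \<forall>G\<in>S. T (F + G) = T F + T G) \<and>
     (\<forall>c. \<forall>F\<in>S. T (l2_scale c F) = l2_scale c (T F))"

definition unitary_between :: "l2 set \<Rightarrow> l2 set \<Rightarrow> (l2 \<Rightarrow> l2) \<Rightarrow> bool" where
  "unitary_between S S' T \<longleftrightarrow> clinear_on S T \<and> bij_betw T S S' \<and>
     (\<forall>F\<in>S. \<forall>G\<in>S. l2_inner (T F) (T G) = l2_inner F G)"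

definition equivariant_on :: "l2 set \<Rightarrow> (l2 \<Rightarrow> l2) \<Rightarrow> bool" where
  "equivariant_on S T \<longleftrightarrow>
     (\<forall>R\<in>SO3. \<forall>F\<in>S. left_translate R F \<in> S \<and> T (left_translate R F) = left_translate R (T F))"

definition orth_compl :: "l2 set \<Rightarrow> l2 set" where
  "orth_compl S = {F. \<forall>G\<in>S. l2_inner F G = 0}"

text \<open>The operator that is \<open>T\<close> on the closed subspace \<open>S\<close> and zero on its orthogonal
  complement: \<open>T\<close> composed with the orthogonal projection onto \<open>S\<close>.\<close>

definition zero_extension :: "l2 set \<Rightarrow> (l2 \<Rightarrow> l2) \<Rightarrow> l2 \<Rightarrow> l2" where
  "zero_extension S T F = T (THE P. P \<in> S \<and> F - P \<in> orth_compl S)"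

text \<open>Bounded operators that are isometric on the orthogonal complement of their kernel.\<close>

definition partial_isometry :: "(l2 \<Rightarrow> l2) \<Rightarrow> bool" where
  "partial_isometry E \<longleftrightarrow> clinear_on UNIV E \<and> (\<exists>K. \<forall>F. l2_norm (E F) \<le> K * l2_norm F) \<and>
     (\<forall>F\<in>orth_compl {G. E G = 0}. l2_norm (E F) = l2_norm F)"

text \<open>The requirements that characterize the transform from \<open>H\<^sup>2(\<partial>M\<^sub>\<tau>)\<close> to \<open>H\<^sup>2(Y)\<close>.\<close>

definition is_transform ::
    "((nat \<Rightarrow> cpoly22) \<Rightarrow> l2) \<Rightarrow> real \<Rightarrow> (l2 \<Rightarrow> l2) \<Rightarrow> bool" where
  "is_transform \<Phi> \<tau> T \<longleftrightarrow>
     unitary_between (hardy_M \<Phi> \<tau>) (hardy_Y \<Phi>) T \<and>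
     equivariant_on (hardy_M \<Phi> \<tau>) T \<and>
     (\<forall>l. \<forall>v\<in>Sym (2 * l).
        T (\<Phi> (block l (tensor v (normalized (2 * l) (w_vec \<tau> l)))))
          = \<Phi> (block l (tensor v (normalized (2 * l) (u_vec l)))))"

end

theory Submission
  imports Defs "HOL-Analysis.Cross3"
begin

text \<open>
  A vector of \<open>H\<^sup>2(\<partial>M\<^sub>\<tau>)\<close> is determined by its inner products with the vectors
  \<open>v \<otimes> w\<^sub>l\<close> supported in a single block. With \<open>a\<^sub>l\<close>, \<open>b\<^sub>l\<close> the normalizations of \<open>w\<^sub>l\<close>, \<open>u\<^sub>l\<close>,
  an isometry onto \<open>H\<^sup>2(Y)\<close> that sends \<open>v \<otimes> a\<^sub>l\<close> to \<open>v \<otimes> b\<^sub>l\<close> is therefore forced to contract the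
  second factor of each block with \<open>a\<^sub>l\<close> and to tensor the result with \<open>b\<^sub>l\<close>; no density argument
  is needed. The same contraction followed by \<open>\<otimes> a\<^sub>l\<close> is the orthogonal projection onto
  \<open>H\<^sup>2(\<partial>M\<^sub>\<tau>)\<close>.

  Invariance of the Hardy spaces under rotations requires the action on \<open>Sym (2 * l)\<close> to be unitary.
  This comes from the reproducing kernel of the inner product, \<open>(z, a) \<mapsto> \<langle>z, a\<rangle>\<^sup>n\<close>, which is
  invariant under SU(2), and from the surjectivity of SU(2) \<open>\<rightarrow>\<close> SO(3): without a lift,
  the choice operator in the definition of \<^const>\<open>so3_rep\<close> would return an arbitrary matrix.
\<close>

section \<open>Homogeneous polynomials\<close>

text \<open>Dehomogenizing at the points (1, t) turns a form into a one-variable polynomial with the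
  same coefficients, and these are determined by its values.\<close>

lemma hom_poly_inject:
  assumes "hom_poly n c = hom_poly n d" "k \<le> n"
  shows "c k = d k"
proof -
  have "(\<Sum>i\<le>n. c i * t ^ i) = (\<Sum>i\<le>n. d i * t ^ i)" for t
    using fun_cong[OF assms(1), of "vector [1, t]"] by (simp add: hom_poly_def mon_def)
  then show ?thesis
    using assms(2) polyfun_eq_coeffs[of c n d] by blast
qed

lemma hom_poly_cong: "(\<And>k. k \<le> n \<Longrightarrow> c k = d k) \<Longrightarrow> hom_poly n c = hom_poly n d"
  by (auto simp: hom_poly_def fun_eq_iff intro!: sum.cong)

text \<open>Requiring zeros above \<open>n\<close> makes the sequence described by
  \<open>hom_coeff\<close> unique; an arbitrary \<open>c\<close> is therefore recovered only after
  truncation.\<close>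

lemma hom_coeff_hom_poly: "hom_coeff n (hom_poly n c) k = (if k \<le> n then c k else 0)"
proof -
  have "hom_coeff n (hom_poly n c) = (\<lambda>k. if k \<le> n then c k else 0)"
    unfolding hom_coeff_def
  proof (rule the_equality)
    fix d assume "(\<forall>k>n. d k = 0) \<and> hom_poly n c = hom_poly n d"
    then show "d = (\<lambda>k. if k \<le> n then c k else 0)"
      using hom_poly_inject[of n c d] by (auto simp: fun_eq_iff)
  qed (auto intro!: hom_poly_cong)
  then show ?thesis by simp
qed

lemma hom_poly_in_Sym [intro, simp]: "hom_poly n c \<in> Sym n"
  by (simp add: Sym_def)

lemma hom_poly_hom_coeff: "p \<in> Sym n \<Longrightarrow> hom_poly n (hom_coeff n p) = p"
  by (auto simp: Sym_def hom_coeff_hom_poly intro!: hom_poly_cong)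

lemma hom_coeff_eq_0: "p \<in> Sym n \<Longrightarrow> k > n \<Longrightarrow> hom_coeff n p k = 0"
  by (auto simp: Sym_def hom_coeff_hom_poly)

lemma hom_poly_sum: "(\<lambda>z. \<Sum>i\<in>I. c i * hom_poly n (d i) z) = hom_poly n (\<lambda>k. \<Sum>i\<in>I. c i * d i k)"
  by (auto simp: hom_poly_def fun_eq_iff sum_distrib_left sum_distrib_right mult.assoc intro: sum.swap)

lemma hom_poly_add: "(\<lambda>z. hom_poly n c z + hom_poly n d z) = hom_poly n (\<lambda>k. c k + d k)"
  by (simp add: hom_poly_def fun_eq_iff sum.distrib distrib_right)

lemma hom_poly_scale: "(\<lambda>z. c * hom_poly n d z) = hom_poly n (\<lambda>k. c * d k)"
  by (simp add: hom_poly_def fun_eq_iff sum_distrib_left mult.assoc)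

lemma hom_coeff_sum:
  assumes "\<And>i. i \<in> I \<Longrightarrow> p i \<in> Sym n"
  shows "hom_coeff n (\<lambda>z. \<Sum>i\<in>I. c i * p i z) k = (\<Sum>i\<in>I. c i * hom_coeff n (p i) k)"
proof -
  have "(\<lambda>z. \<Sum>i\<in>I. c i * p i z) = (\<lambda>z. \<Sum>i\<in>I. c i * hom_poly n (hom_coeff n (p i)) z)"
    using assms by (auto simp: hom_poly_hom_coeff intro!: sum.cong)
  also have "\<dots> = hom_poly n (\<lambda>k. \<Sum>i\<in>I. c i * hom_coeff n (p i) k)"
    by (rule hom_poly_sum)
  finally show ?thesis
    using assms by (auto simp: hom_coeff_hom_poly hom_coeff_eq_0)
qed

lemma Sym_sum:
  assumes "\<And>i. i \<in> I \<Longrightarrow> p i \<in> Sym n"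
  shows "(\<lambda>z. \<Sum>i\<in>I. c i * p i z) \<in> Sym n"
proof -
  have "(\<lambda>z. \<Sum>i\<in>I. c i * p i z) = (\<lambda>z. \<Sum>i\<in>I. c i * hom_poly n (hom_coeff n (p i)) z)"
    using assms by (auto simp: hom_poly_hom_coeff intro!: sum.cong)
  then show ?thesis by (simp add: hom_poly_sum)
qed

lemma Sym_scale: "p \<in> Sym n \<Longrightarrow> (\<lambda>z. c * p z) \<in> Sym n"
  by (auto simp: Sym_def hom_poly_scale)

lemma mon_in_Sym: "k \<le> n \<Longrightarrow> mon n k \<in> Sym n"
  by (auto simp: Sym_def hom_poly_def fun_eq_iff if_distrib[of "\<lambda>x. x * _"] cong: if_cong
      intro!: range_eqI[of _ _ "\<lambda>i. if i = k then 1 else 0"])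

lemma Sym_mult:
  assumes "p \<in> Sym m" "q \<in> Sym n"
  shows "(\<lambda>z. p z * q z) \<in> Sym (m + n)"
proof -
  obtain c d where cd: "p = hom_poly m c" "q = hom_poly n d"
    using assms by (auto simp: Sym_def)
  \<comment> \<open>The exponents \<open>n - k\<close> are truncated differences, so they add up
    only for indices within range.\<close>
  have mon: "mon m i z * mon n j z = mon (m + n) (i + j) z" if "i \<le> m" "j \<le> n" for i j z
  proof -
    have "m + n - (i + j) = (m - i) + (n - j)" using that by simp
    then show ?thesis by (simp add: mon_def power_add)
  qed
  have "(\<lambda>z. p z * q z) =
      (\<lambda>z. \<Sum>i\<le>m. c i * (\<Sum>j\<le>n. d j * mon (m + n) (i + j) z))"
    unfolding cd hom_poly_def sum_product
    by (intro ext sum.cong refl) (auto simp: mon[symmetric] sum_distrib_left mult_ac intro!: sum.cong)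
  also have "\<dots> \<in> Sym (m + n)"
    by (intro Sym_sum mon_in_Sym) auto
  finally show ?thesis .
qed

lemma Sym_power: "p \<in> Sym m \<Longrightarrow> (\<lambda>z. p z ^ n) \<in> Sym (m * n)"
proof (induction n)
  case 0
  have "mon 0 0 \<in> Sym 0" by (rule mon_in_Sym) simp
  then show ?case by (simp add: mon_def)
next
  case (Suc n)
  then show ?case using Sym_mult[of p m "\<lambda>z. p z ^ n" "m * n"] by simp
qed

lemma Sym_linear_subst:
  assumes "p \<in> Sym n"
  shows "(\<lambda>z. p (B *v z)) \<in> Sym n"
proof -
  \<comment> \<open>\<open>mon 1 0\<close> and \<open>mon 1 1\<close> are the two coordinates, so
    the coefficients are the entries of row \<open>i\<close>. Monomials in \<open>B *v z\<close> are
    then products of powers of linear forms.\<close>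
  have lin: "(\<lambda>z. (B *v z) $ i) \<in> Sym 1" for i
    unfolding Sym_def
    by (rule range_eqI[of _ _ "\<lambda>k. if k = 0 then B $ i $ 1 else B $ i $ 2"])
      (simp add: hom_poly_def mon_def fun_eq_iff matrix_vector_mult_def sum_2)
  have "(\<lambda>z. mon n k (B *v z)) \<in> Sym n" if "k \<le> n" for k
    using Sym_mult[OF Sym_power[OF lin, of 1 "n - k"] Sym_power[OF lin, of 2 k]] that
    by (simp add: mon_def)
  then have "(\<lambda>z. \<Sum>k\<le>n. hom_coeff n p k * mon n k (B *v z)) \<in> Sym n"
    by (intro Sym_sum) auto
  also have "(\<lambda>z. \<Sum>k\<le>n. hom_coeff n p k * mon n k (B *v z)) = (\<lambda>z. p (B *v z))"
    using hom_poly_hom_coeff[OF assms] by (auto simp: hom_poly_def fun_eq_iff)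
  finally show ?thesis .
qed

section \<open>The invariant inner product\<close>

lemma sym_inner_hom_poly:
  "sym_inner n (hom_poly n c) (hom_poly n d) = (\<Sum>k\<le>n. c k * cnj (d k) / of_nat (n choose k))"
  by (auto simp: sym_inner_def hom_coeff_hom_poly)

lemma sym_inner_cnj: "cnj (sym_inner n p q) = sym_inner n q p"
  by (simp add: sym_inner_def mult.commute)

lemma sym_inner_sum_left:
  assumes "\<And>i. i \<in> I \<Longrightarrow> p i \<in> Sym n"
  shows "sym_inner n (\<lambda>z. \<Sum>i\<in>I. c i * p i z) q = (\<Sum>i\<in>I. c i * sym_inner n (p i) q)"
  unfolding sym_inner_def
  by (simp add: hom_coeff_sum[OF assms] sum_distrib_left sum_distrib_right sum_divide_distrib
      mult.assoc sum.swap[of _ "{..n}"])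

lemma sym_inner_sum_right:
  assumes "\<And>i. i \<in> I \<Longrightarrow> q i \<in> Sym n"
  shows "sym_inner n p (\<lambda>z. \<Sum>i\<in>I. c i * q i z) = (\<Sum>i\<in>I. cnj (c i) * sym_inner n p (q i))"
  using sym_inner_sum_left[OF assms, where q = p and c = c, THEN arg_cong[where f = cnj]]
  by (simp add: sym_inner_cnj)

lemma sym_inner_scale_left: "p \<in> Sym n \<Longrightarrow> sym_inner n (\<lambda>z. c * p z) q = c * sym_inner n p q"
  using sym_inner_sum_left[of "{()}" "\<lambda>_. p" n "\<lambda>_. c" q] by simp

lemma sym_inner_scale_right: "q \<in> Sym n \<Longrightarrow> sym_inner n p (\<lambda>z. c * q z) = cnj c * sym_inner n p q"
  using sym_inner_sum_right[of "{()}" "\<lambda>_. q" n p "\<lambda>_. c"] by simp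

lemma sym_inner_add_left:
  "p \<in> Sym n \<Longrightarrow> q \<in> Sym n \<Longrightarrow> sym_inner n (\<lambda>z. p z + q z) r = sym_inner n p r + sym_inner n q r"
  \<comment> \<open>A binary sum is a sum indexed by the type of booleans.\<close>
  using sym_inner_sum_left[of UNIV "\<lambda>b. if b then p else q" n "\<lambda>_. 1" r]
  by (auto simp: UNIV_bool add.commute split: if_splits)

lemma sym_inner_zero_left [simp]: "sym_inner n (\<lambda>z. 0) q = 0"
  using sym_inner_sum_left[of "{}" "\<lambda>_. q" n "\<lambda>_. 0" q] by simp

lemma Re_sym_inner_self: "Re (sym_inner n p p) = (\<Sum>k\<le>n. (cmod (hom_coeff n p k))\<^sup>2 / (n choose k))"
proof -
  have "a * cnj a / of_nat m = of_real ((cmod a)\<^sup>2 / real m)" for a and m :: nat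
    by (metis complex_norm_square of_real_divide of_real_of_nat_eq)
  then show ?thesis
    by (simp only: sym_inner_def Re_sum Re_complex_of_real)
qed

lemma sym_inner_self: "sym_inner n p p = of_real ((sym_norm n p)\<^sup>2)"
proof -
  have "Re (sym_inner n p p) \<ge> 0"
    by (auto simp: Re_sym_inner_self intro!: sum_nonneg)
  moreover have "Im (sym_inner n p p) = 0"
    using arg_cong[OF sym_inner_cnj[of n p p], of Im] by simp
  ultimately show ?thesis
    by (simp add: complex_eq_iff sym_norm_def)
qed

text \<open>Pairing with \<open>mon n k\<close> reads off the coefficient of index \<open>k\<close>
  up to the nonzero factor 1 / (n choose k).\<close>

lemma sym_inner_eqI:
  assumes "p \<in> Sym n" "p' \<in> Sym n" "\<And>q. q \<in> Sym n \<Longrightarrow> sym_inner n p q = sym_inner n p' q"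
  shows "p = p'"
proof -
  have *: "sym_inner n q (mon n k) = hom_coeff n q k / of_nat (n choose k)" if "k \<le> n" for q k
  proof -
    have "mon n k = hom_poly n (\<lambda>i. if i = k then 1 else 0)"
      using that by (simp add: hom_poly_def fun_eq_iff if_distrib[of "\<lambda>x. x * _"] cong: if_cong)
    then show ?thesis
      using that by (simp add: sym_inner_def hom_coeff_hom_poly if_distrib[of cnj]
          if_distrib[of "\<lambda>x. _ * x"] if_distrib[of "\<lambda>x. x / _"] cong: if_cong)
  qed
  have "hom_coeff n p k = hom_coeff n p' k" if "k \<le> n" for k
    using assms(3)[OF mon_in_Sym[OF that]] that by (simp add: *)
  then have "hom_poly n (hom_coeff n p) = hom_poly n (hom_coeff n p')"
    by (intro hom_poly_cong)
  then show ?thesis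
    using assms by (simp add: hom_poly_hom_coeff)
qed

section \<open>Reproducing kernel and adjoints of linear substitutions\<close>

text \<open>The reproducing kernel at \<open>a\<close>: the binomial weights compensate the squared
  norms of the monomials.\<close>

definition kern :: "nat \<Rightarrow> complex^2 \<Rightarrow> cpoly2" where
  "kern n a = (\<lambda>z. \<Sum>k\<le>n. (of_nat (n choose k) * cnj (mon n k a)) * mon n k z)"

text \<open>The closed form shows how the kernel transforms under linear maps, which the monomial
  expansion hides.\<close>

lemma kern_eq: "kern n a z = (\<Sum>i\<in>UNIV. z $ i * cnj (a $ i)) ^ n"
  \<comment> \<open>The binomial theorem puts the exponent \<open>k\<close> on the first summand,
    \<open>mon\<close> on the second coordinate; hence the swap of the summands.\<close>
  unfolding sum_2 binomial_ring[of "z $ 1 * _"] binomial_ring[of "z $ 2 * _"] kern_def add.commute[of "z $ 1 * _"]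
  by (intro sum.cong refl) (simp add: mon_def power_mult_distrib)

lemma kern_adjoint: "kern n a (adjoint_matrix B *v z) = kern n (B *v a) z"
  by (simp add: kern_eq sum_2 matrix_vector_mult_def adjoint_matrix_def algebra_simps)

lemma sym_inner_kern:
  assumes "p \<in> Sym n"
  shows "sym_inner n p (kern n a) = p a"
proof -
  have "kern n a = hom_poly n (\<lambda>k. of_nat (n choose k) * cnj (mon n k a))"
    by (simp add: kern_def hom_poly_def)
  then have "sym_inner n p (kern n a) = (\<Sum>k\<le>n. hom_coeff n p k * mon n k a)"
    by (simp add: sym_inner_def hom_coeff_hom_poly)
  also have "\<dots> = p a"
    using hom_poly_hom_coeff[OF assms] by (auto simp: hom_poly_def fun_eq_iff)
  finally show ?thesis .
qed

text \<open>By \<open>kern_adjoint\<close>, substitution of the adjoint matrix carries kernels to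
  kernels. Since pairing with a kernel evaluates a form at a point, the adjoint of the substitution
  is found without expanding powers of the entries of \<open>B\<close>.\<close>

lemma sym_inner_adjoint:
  assumes "p \<in> Sym n" "q \<in> Sym n"
  shows "sym_inner n (\<lambda>z. p (B *v z)) q = sym_inner n p (\<lambda>z. q (adjoint_matrix B *v z))"
proof -
  let ?m = "\<lambda>k z. mon n k (adjoint_matrix B *v z)"
  have m: "?m k \<in> Sym n" if "k \<le> n" for k
    using that by (intro Sym_linear_subst mon_in_Sym)
  \<comment> \<open>\<open>f\<close> is the Riesz representative of \<open>q \<mapsto> \<langle>p, q \<circ> B\<^sup>*\<rangle>\<close>; testing it against the kernel gives \<open>f = p \<circ> B\<close>.\<close>
  define f where "f = hom_poly n (\<lambda>k. of_nat (n choose k) * sym_inner n p (?m k))"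
  have "f a = p (B *v a)" for a
  proof -
    have "f a = (\<Sum>k\<le>n. cnj (of_nat (n choose k) * cnj (mon n k a)) * sym_inner n p (?m k))"
      by (simp add: f_def hom_poly_def mult_ac)
    also have "\<dots> = sym_inner n p (\<lambda>z. \<Sum>k\<le>n. (of_nat (n choose k) * cnj (mon n k a)) * ?m k z)"
      using m by (intro sym_inner_sum_right[symmetric]) auto
    also have "(\<lambda>z. \<Sum>k\<le>n. (of_nat (n choose k) * cnj (mon n k a)) * ?m k z) = kern n (B *v a)"
      by (rule ext, subst kern_adjoint[symmetric]) (simp add: kern_def)
    finally show ?thesis using assms by (simp add: sym_inner_kern)
  qed
  then have "sym_inner n (\<lambda>z. p (B *v z)) q = sym_inner n f q"
    by presburger
  \<comment> \<open>The binomial factor in \<open>f\<close> cancels the weight of the inner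
    product.\<close>
  also have "\<dots> = (\<Sum>k\<le>n. cnj (hom_coeff n q k) * sym_inner n p (?m k))"
    by (auto simp: f_def sym_inner_def[of _ "hom_poly n _"] hom_coeff_hom_poly intro!: sum.cong)
  also have "\<dots> = sym_inner n p (\<lambda>z. \<Sum>k\<le>n. hom_coeff n q k * ?m k z)"
    using m by (intro sym_inner_sum_right[symmetric]) auto
  also have "(\<lambda>z. \<Sum>k\<le>n. hom_coeff n q k * ?m k z) = (\<lambda>z. q (adjoint_matrix B *v z))"
    using hom_poly_hom_coeff[OF assms(2)] by (auto simp: hom_poly_def fun_eq_iff)
  finally show ?thesis .
qed

text \<open>Moving the left substitution to the right argument produces the substitution of
  \<open>B ** adjoint_matrix B\<close> there.\<close>

lemma sym_inner_unitary_subst: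
  assumes "B ** adjoint_matrix B = mat 1" "p \<in> Sym n" "q \<in> Sym n"
  shows "sym_inner n (\<lambda>z. p (B *v z)) (\<lambda>z. q (B *v z)) = sym_inner n p q"
  using assms by (simp add: sym_inner_adjoint Sym_linear_subst matrix_vector_mul_assoc)

section \<open>Surjectivity of the double cover\<close>

lemma mat22_eq_iff:
  "A = B \<longleftrightarrow> A $ 1 $ 1 = B $ 1 $ 1 \<and> A $ 1 $ 2 = B $ 1 $ 2 \<and> A $ 2 $ 1 = B $ 2 $ 1 \<and> A $ 2 $ 2 = B $ 2 $ 2"
  for A B :: "'a^2^2"
  by (auto simp: vec_eq_iff forall_2)

lemma adjoint_matrix_mult: "adjoint_matrix (A ** B) = adjoint_matrix B ** adjoint_matrix A"
  by (simp add: mat22_eq_iff matrix_matrix_mult_def adjoint_matrix_def sum_2 mult.commute)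

lemma adjoint_matrix_adjoint [simp]: "adjoint_matrix (adjoint_matrix A) = A"
  by (simp add: mat22_eq_iff adjoint_matrix_def)

lemma mat22_add_rdistrib: "(A + B) ** C = A ** C + B ** C" for A B C :: "complex^2^2"
  by (simp add: mat22_eq_iff matrix_matrix_mult_def sum_2 distrib_right)

lemma SU2_adjoint_left: "A \<in> SU2 \<Longrightarrow> adjoint_matrix A ** A = mat 1"
  by (simp add: SU2_def matrix_left_right_inverse)

lemma adjoint_matrix_in_SU2:
  assumes "A \<in> SU2" shows "adjoint_matrix A \<in> SU2"
proof -
  have "det (adjoint_matrix A) = cnj (det A)"
    by (simp add: det_2 adjoint_matrix_def mult.commute)
  then show ?thesis
    using assms by (simp add: SU2_def SU2_adjoint_left)
qed

text \<open>\<open>matrix_inv\<close> is a choice, so a two-sided inverse has to be exhibited before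
  anything is known about it.\<close>

lemma matrix_inv_SU2:
  assumes "A \<in> SU2" shows "matrix_inv A = adjoint_matrix A"
proof -
  have A: "A ** adjoint_matrix A = mat 1" "adjoint_matrix A ** A = mat 1"
    using assms SU2_adjoint_left[OF assms] by (auto simp: SU2_def)
  then have "A ** matrix_inv A = mat 1"
    unfolding matrix_inv_def by (metis (mono_tags, lifting) someI_ex)
  then have "adjoint_matrix A ** (A ** matrix_inv A) = adjoint_matrix A"
    by simp
  then show ?thesis
    by (simp add: matrix_mul_assoc A)
qed

lemma SU2_mult: "A \<in> SU2 \<Longrightarrow> B \<in> SU2 \<Longrightarrow> A ** B \<in> SU2"
proof -
  assume *: "A \<in> SU2" "B \<in> SU2"
  have "A ** B ** (adjoint_matrix B ** adjoint_matrix A) = A ** (B ** adjoint_matrix B) ** adjoint_matrix A"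
    by (simp add: matrix_mul_assoc)
  then show ?thesis
    using * by (simp add: SU2_def det_mul adjoint_matrix_mult)
qed

lemma pauli_nth:
  "pauli x $ 1 $ 1 = of_real (x $ 3)" "pauli x $ 1 $ 2 = Complex (x $ 1) (- (x $ 2))"
  "pauli x $ 2 $ 1 = Complex (x $ 1) (x $ 2)" "pauli x $ 2 $ 2 = - of_real (x $ 3)"
  by (simp_all add: pauli_def)

text \<open>One matrix product carries both the inner and the cross product: unit vectors give
  involutions, orthogonal vectors give anticommuting matrices, and two axes produce the third.
  \<open>mat \<i>\<close> is the scalar i written as a matrix.\<close>

lemma pauli_mult: "pauli x ** pauli y = mat (of_real (x \<bullet> y)) + mat \<i> ** pauli (cross3 x y)"
  by (simp add: mat22_eq_iff matrix_matrix_mult_def mat_def sum_2 sum_3 pauli_nth inner_vec_def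
      cross_components complex_eq_iff algebra_simps)

lemma adjoint_matrix_pauli [simp]: "adjoint_matrix (pauli x) = pauli x"
  by (simp add: mat22_eq_iff adjoint_matrix_def pauli_nth complex_eq_iff)

text \<open>The parametrization of SU(2) by unit vectors of \<complex>^2, that is, by unit
  quaternions.\<close>

definition su :: "complex \<Rightarrow> complex \<Rightarrow> complex^2^2" where
  "su a b = vector [vector [a, - cnj b], vector [b, cnj a]]"

lemma su_nth:
  "su a b $ 1 $ 1 = a" "su a b $ 1 $ 2 = - cnj b" "su a b $ 2 $ 1 = b" "su a b $ 2 $ 2 = cnj a"
  by (simp_all add: su_def)

lemma su_in_SU2:
  assumes "(cmod a)\<^sup>2 + (cmod b)\<^sup>2 = 1"
  shows "su a b \<in> SU2"
proof -
  have "(Re a * Re a + Im a * Im a) + (Re b * Re b + Im b * Im b) = 1"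
    using assms by (simp add: cmod_power2 flip: power2_eq_square)
  then show ?thesis
    by (simp add: SU2_def mat22_eq_iff matrix_matrix_mult_def adjoint_matrix_def mat_def det_2 sum_2
        su_nth complex_eq_iff algebra_simps)
qed

text \<open>The first column of \<open>A\<close> has to be a unit eigenvector of
  \<open>pauli p\<close> for the eigenvalue 1. The vector (1 + p3, p1 + i p2) is an eigenvector
  except at the south pole, where it vanishes; that point is treated apart.\<close>

lemma SU2_moves_third_axis:
  assumes "norm p = 1"
  obtains A where "A \<in> SU2" "A ** pauli (axis 3 1) ** adjoint_matrix A = pauli p"
proof -
  have p: "(p $ 1)\<^sup>2 + (p $ 2)\<^sup>2 + (p $ 3)\<^sup>2 = 1"
    using assms by (simp add: norm_eq_1 inner_vec_def sum_3 power2_eq_square)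
  show ?thesis
  proof (cases "p $ 3 = -1")
    case True
    then have "p $ 1 = 0" "p $ 2 = 0"
      using p by (auto simp: sum_power2_eq_zero_iff)
    with True have "su 0 1 ** pauli (axis 3 1) ** adjoint_matrix (su 0 1) = pauli p"
      by (simp add: mat22_eq_iff matrix_matrix_mult_def adjoint_matrix_def sum_2 su_nth pauli_nth
          axis_def complex_eq_iff)
    moreover have "su 0 1 \<in> SU2" by (simp add: su_in_SU2)
    ultimately show ?thesis by (intro that)
  next
    case False
    have "(p $ 3)\<^sup>2 \<le> 1"
      using p by (smt (verit) zero_le_power2)
    then have pos: "1 + p $ 3 > 0"
      using False by (auto simp: abs_square_le_1)
    \<comment> \<open>\<open>c\<close> is the cosine of half the polar angle of \<open>p\<close>.
      The value of \<open>b\<close> is forced by the lower left entry of the conjugated matrix,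
      which is 2 c b and must equal p1 + i p2.\<close>
    define c where "c = sqrt ((1 + p $ 3) / 2)"
    define b where "b = Complex (p $ 1) (p $ 2) / of_real (2 * c)"
    have c: "c > 0" "c\<^sup>2 = (1 + p $ 3) / 2"
      using pos by (auto simp: c_def)
    have "(cmod b)\<^sup>2 = ((p $ 1)\<^sup>2 + (p $ 2)\<^sup>2) / (4 * c\<^sup>2)"
      by (simp add: b_def norm_divide norm_mult power_divide power_mult_distrib cmod_power2)
    also have "(p $ 1)\<^sup>2 + (p $ 2)\<^sup>2 = (1 + p $ 3) * (1 - p $ 3)"
      using p by (simp add: algebra_simps power2_eq_square)
    also have "\<dots> / (4 * c\<^sup>2) = (1 - p $ 3) / 2"
      using pos by (simp add: c(2) field_simps)
    finally have b2: "(cmod b)\<^sup>2 = (1 - p $ 3) / 2" .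
    have "su (of_real c) b \<in> SU2"
      using c b2 by (intro su_in_SU2) (simp add: field_simps)
    moreover have "of_real (2 * c) * b = Complex (p $ 1) (p $ 2)"
      using c by (simp add: b_def)
    then have b': "2 * c * Re b = p $ 1" "2 * c * Im b = p $ 2"
      by (simp_all add: complex_eq_iff)
    have b3: "Re b * Re b + Im b * Im b = (1 - p $ 3) / 2"
      using b2 by (simp add: cmod_power2 flip: power2_eq_square)
    have c3: "c * c = (1 + p $ 3) / 2" using c(2) by (simp add: power2_eq_square)
    have "su (of_real c) b ** pauli (axis 3 1) ** adjoint_matrix (su (of_real c) b) = pauli p"
      using b' b3 c3
      by (simp add: mat22_eq_iff matrix_matrix_mult_def adjoint_matrix_def sum_2 su_nth pauli_nth
          axis_def complex_eq_iff field_simps)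
    ultimately show ?thesis by (rule that)
  qed
qed

lemma conj_cancel:
  fixes A :: "complex^2^2"
  assumes "A \<in> SU2"
  shows "A ** (adjoint_matrix A ** M) = M" "adjoint_matrix A ** (A ** M) = M"
  using assms SU2_adjoint_left[OF assms] by (simp_all add: matrix_mul_assoc SU2_def)

lemma conj_mult:
  fixes A :: "complex^2^2"
  assumes "A \<in> SU2"
  shows "A ** (M ** N) ** adjoint_matrix A = (A ** M ** adjoint_matrix A) ** (A ** N ** adjoint_matrix A)"
  using assms by (simp add: matrix_mul_assoc[symmetric] conj_cancel)

text \<open>Anticommuting with \<open>pauli (axis 3 1)\<close> kills the diagonal of
  \<open>M\<close>; a Hermitian involution of this shape is given by one off-diagonal entry on the
  unit circle. A diagonal element of SU(2) moves that entry to any prescribed place on the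
  circle.\<close>

lemma SU2_fixes_third_axis:
  assumes M: "adjoint_matrix M = M" "M ** M = mat 1"
    and anti: "M ** pauli (axis 3 1) + pauli (axis 3 1) ** M = 0"
  obtains D where "D \<in> SU2" "D ** pauli (axis 3 1) ** adjoint_matrix D = pauli (axis 3 1)"
    "D ** pauli (axis 1 1) ** adjoint_matrix D = M"
proof -
  \<comment> \<open>Conjugation by \<open>su d 0\<close> multiplies the upper right entry by the
    square of \<open>d\<close>, hence the square root.\<close>
  define d where "d = csqrt (M $ 1 $ 2)"
  have diag: "M $ 1 $ 1 = 0" "M $ 2 $ 2 = 0"
    using anti by (auto simp: mat22_eq_iff matrix_matrix_mult_def sum_2 pauli_nth axis_def
        zero_complex.code[symmetric])
  have adj: "M $ 2 $ 1 = cnj (M $ 1 $ 2)"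
    using M(1) by (auto simp: mat22_eq_iff adjoint_matrix_def)
  have "M $ 1 $ 2 * cnj (M $ 1 $ 2) = 1"
    using M(2) diag by (simp add: mat22_eq_iff matrix_matrix_mult_def sum_2 mat_def adj)
  then have "(cmod (M $ 1 $ 2))\<^sup>2 = 1"
    unfolding complex_norm_square[symmetric] by (metis of_real_eq_1_iff)
  then have "cmod (M $ 1 $ 2) = 1"
    by (metis norm_ge_zero power2_eq_1_iff real_sqrt_one real_sqrt_unique)
  moreover have d2: "d * d = M $ 1 $ 2"
    by (simp add: d_def flip: power2_eq_square)
  moreover have d2_cnj: "cnj d * cnj d = cnj (M $ 1 $ 2)"
    by (metis d2 complex_cnj_mult)
  ultimately have "cmod d * cmod d = 1"
    by (simp flip: norm_mult)
  then have d1: "(cmod d)\<^sup>2 = 1" by (simp add: power2_eq_square)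
  then have dd: "d * cnj d = 1"
    by (simp flip: complex_norm_square)
  show ?thesis
  proof
    show "su d 0 \<in> SU2" using d1 by (simp add: su_in_SU2)
    show "su d 0 ** pauli (axis 3 1) ** adjoint_matrix (su d 0) = pauli (axis 3 1)"
      using dd by (simp add: mat22_eq_iff matrix_matrix_mult_def adjoint_matrix_def sum_2 su_nth pauli_nth
          axis_def complex_eq_iff algebra_simps)
    show "su d 0 ** pauli (axis 1 1) ** adjoint_matrix (su d 0) = M"
      using d2 d2_cnj diag adj
      by (simp add: mat22_eq_iff matrix_matrix_mult_def adjoint_matrix_def sum_2 su_nth pauli_nth
          axis_def zero_complex.code[symmetric] one_complex.code[symmetric])
  qed
qed

text \<open>It suffices to match the third and the first axis: the second one follows from
  \<open>\<sigma>\<^sub>3 \<sigma>\<^sub>1 = \<i> \<sigma>\<^sub>2\<close> and the invariance of the cross product under rotations.\<close>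

lemma covers_surj:
  assumes "R \<in> SO3"
  obtains A where "A \<in> SU2" "covers A R"
proof -
  let ?e = "\<lambda>i. axis i 1 :: real^3"
  have R: "orthogonal_matrix R" "det R = 1" using assms by (auto simp: SO3_def)
  then have ot: "orthogonal_transformation ((*v) R)"
    by (simp add: orthogonal_transformation_matrix)
  have inner: "(R *v x) \<bullet> (R *v y) = x \<bullet> y" for x y
    using ot by (simp add: orthogonal_transformation_def)
  define p q where "p = R *v ?e 3" and "q = R *v ?e 1"
  have norms: "norm p = 1" "q \<bullet> q = 1" "p \<bullet> q = 0" "q \<bullet> p = 0"
    by (simp_all add: p_def q_def norm_eq_1 inner inner_axis_axis)
  obtain B where B: "B \<in> SU2" "B ** pauli (?e 3) ** adjoint_matrix B = pauli p"
    using SU2_moves_third_axis[OF norms(1)] .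
  \<comment> \<open>Pulling \<open>pauli q\<close> back by \<open>B\<close> leaves a rotation about
    the third axis to be found; it does not disturb the axis already matched.\<close>
  define M where "M = adjoint_matrix B ** pauli q ** B"
  have B': "adjoint_matrix B \<in> SU2" 
    by (rule adjoint_matrix_in_SU2[OF B(1)])
  have e3: "pauli (?e 3) = adjoint_matrix B ** pauli p ** B"
    using B by (simp add: B(2)[symmetric] matrix_mul_assoc[symmetric] conj_cancel SU2_adjoint_left)
  obtain D where D: "D \<in> SU2" "D ** pauli (?e 3) ** adjoint_matrix D = pauli (?e 3)"
    "D ** pauli (?e 1) ** adjoint_matrix D = M"
  proof (rule SU2_fixes_third_axis)
    show "adjoint_matrix M = M"
      by (simp add: M_def adjoint_matrix_mult matrix_mul_assoc)
    have "M ** M = adjoint_matrix B ** (pauli q ** pauli q) ** B"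
      using conj_mult[OF B', of "pauli q" "pauli q"] by (simp add: M_def)
    also have "pauli q ** pauli q = mat 1"
      by (simp add: pauli_mult norms cross_refl) (simp add: mat22_eq_iff pauli_nth matrix_matrix_mult_def sum_2 mat_def complex_eq_iff)
    finally show "M ** M = mat 1" using B by (simp add: SU2_adjoint_left)
    have "pauli q ** pauli p + pauli p ** pauli q = 0"
      by (simp add: pauli_mult norms cross_skew[of q p])
        (simp add: mat22_eq_iff pauli_nth matrix_matrix_mult_def sum_2 mat_def complex_eq_iff)
    then have "adjoint_matrix B ** (pauli q ** pauli p + pauli p ** pauli q) ** B = 0"
      by simp
    then show "M ** pauli (?e 3) + pauli (?e 3) ** M = 0"
      using conj_mult[OF B', of "pauli q" "pauli p"] conj_mult[OF B', of "pauli p" "pauli q"]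
      by (simp add: M_def e3 matrix_add_ldistrib mat22_add_rdistrib)
  qed
  define A where "A = B ** D"
  have A: "A \<in> SU2" using B D by (simp add: A_def SU2_mult)
  have A_conj: "A ** N ** adjoint_matrix A = B ** (D ** N ** adjoint_matrix D) ** adjoint_matrix B" for N
    by (simp add: A_def adjoint_matrix_mult matrix_mul_assoc)
  have A3: "A ** pauli (?e 3) ** adjoint_matrix A = pauli p"
    by (simp add: A_conj D B)
  have A1: "A ** pauli (?e 1) ** adjoint_matrix A = pauli q"
    unfolding A_conj D(3) M_def using B(1) conj_cancel[OF B(1), of "mat 1"]
    by (simp add: matrix_mul_assoc[symmetric] conj_cancel)
  have i_pauli: "mat \<i> ** pauli (?e 2) = pauli (?e 3) ** pauli (?e 1)"
    by (simp add: pauli_mult cross_basis inner_axis_axis)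
  have "mat \<i> ** (A ** pauli (?e 2) ** adjoint_matrix A) = A ** (mat \<i> ** pauli (?e 2)) ** adjoint_matrix A"
    by (simp add: mat22_eq_iff matrix_matrix_mult_def sum_2 mat_def algebra_simps)
  also have "\<dots> = pauli p ** pauli q"
    using conj_mult[OF A] A1 A3 by (simp add: i_pauli)
  also have "\<dots> = mat \<i> ** pauli (R *v ?e 2)"
    using cross_orthogonal_matrix[OF R(1), of "?e 3" "?e 1"]
    by (simp add: pauli_mult norms) (simp add: p_def q_def R cross_basis)
  finally have A2: "A ** pauli (?e 2) ** adjoint_matrix A = pauli (R *v ?e 2)"
    by (simp add: mat22_eq_iff matrix_matrix_mult_def sum_2 mat_def)
  have "A ** pauli x ** adjoint_matrix A = pauli (R *v x)" for x
  proof -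
    have conj: "A ** (a *\<^sub>R K + b *\<^sub>R M + c *\<^sub>R N) ** adjoint_matrix A =
        a *\<^sub>R (A ** K ** adjoint_matrix A) + b *\<^sub>R (A ** M ** adjoint_matrix A)
          + c *\<^sub>R (A ** N ** adjoint_matrix A)" for a b c K M N
      by (simp add: mat22_eq_iff matrix_matrix_mult_def sum_2 scaleR_conv_of_real[where 'a = complex] algebra_simps)
    \<comment> \<open>Taken at \<open>mat 1\<close> and at \<open>R\<close>, this expands both sides
      of the covering identity in the three axes.\<close>
    have lin: "pauli (S *v x) = x $ 1 *\<^sub>R pauli (S *v ?e 1) + x $ 2 *\<^sub>R pauli (S *v ?e 2)
        + x $ 3 *\<^sub>R pauli (S *v ?e 3)" for S
      by (simp add: mat22_eq_iff pauli_nth matrix_vector_mult_def sum_3 axis_def complex_eq_iff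
          algebra_simps)
    show ?thesis
      using lin[of "mat 1"] lin[of R] by (simp add: conj A1 A2 A3 p_def q_def)
  qed
  then show ?thesis using A by (intro that) (auto simp: covers_def)
qed

section \<open>Unitarity of the rotation action on forms\<close>

text \<open>Surjectivity of the cover supplies the witness for the choice in \<open>so3_rep\<close>,
  whose action is thus substitution of one unitary matrix.\<close>

lemma so3_rep_eq:
  assumes "R \<in> SO3"
  shows "\<exists>B. B ** adjoint_matrix B = mat 1 \<and> (\<forall>p. so3_rep R p = (\<lambda>z. p (B *v z)))"
proof -
  define A where "A = (SOME A. A \<in> SU2 \<and> covers A R)"
  obtain A' where "A' \<in> SU2 \<and> covers A' R"
    using covers_surj[OF assms] by blast
  then have "A \<in> SU2 \<and> covers A R"
    unfolding A_def by (rule someI)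
  then have "matrix_inv A ** adjoint_matrix (matrix_inv A) = mat 1"
    by (simp add: matrix_inv_SU2 SU2_adjoint_left)
  moreover have "so3_rep R p = (\<lambda>z. p (matrix_inv A *v z))" for p
    by (simp add: so3_rep_def A_def Let_def)
  ultimately show ?thesis by blast
qed

lemma so3_rep_unitary:
  assumes "R \<in> SO3" "p \<in> Sym n" "q \<in> Sym n"
  shows "sym_inner n (so3_rep R p) (so3_rep R q) = sym_inner n p q"
  using so3_rep_eq[OF assms(1)] assms(2,3) by (auto simp: sym_inner_unitary_subst)

lemma so3_rep_in_Sym: "R \<in> SO3 \<Longrightarrow> p \<in> Sym n \<Longrightarrow> so3_rep R p \<in> Sym n"
  using so3_rep_eq[of R] by (auto simp: Sym_linear_subst)

section \<open>Tensor products and contraction\<close>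

text \<open>Coordinates on the tensor product: \<open>x j k\<close> belongs to
  \<open>mon n j z * mon n k z'\<close>. The nesting mirrors that of \<open>tensor_coeff\<close>: a
  form in the second variable whose coefficients are forms in the first.\<close>

definition tens :: "nat \<Rightarrow> (nat \<Rightarrow> nat \<Rightarrow> complex) \<Rightarrow> cpoly22" where
  "tens n x = (\<lambda>z. hom_poly n (\<lambda>k. hom_poly n (\<lambda>j. x j k) z))"

lemma tensor_hom_poly: "tensor (hom_poly n c) (hom_poly n d) = tens n (\<lambda>j k. c j * d k)"
proof -
  have "hom_poly n (\<lambda>j. c j * d k) z = hom_poly n c z * d k" for k z
    by (simp add: hom_poly_def sum_distrib_left sum_distrib_right mult_ac)
  then show ?thesis
    by (simp add: tensor_def tens_def fun_cong[OF hom_poly_scale])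
qed

lemma tens_in_Sym_tensor: "tens n x \<in> Sym_tensor n"
proof -
  \<comment> \<open>One simple tensor for each of the \<open>n + 1\<close> monomials in the second
    variable.\<close>
  have "tens n x = (\<lambda>z z'. \<Sum>k<Suc n. tensor (hom_poly n (\<lambda>j. x j k)) (mon n k) z z')"
    unfolding lessThan_Suc_atMost tens_def tensor_def
    by (subst (1) hom_poly_def) (rule refl)
  then show ?thesis
    unfolding Sym_tensor_def using mon_in_Sym
    by (intro CollectI exI[of _ "Suc n"] exI[of _ "\<lambda>k. hom_poly n (\<lambda>j. x j k)"] exI[of _ "mon n"]) auto
qed

text \<open>Reduces statements about sums of simple tensors of unspecified length to computations
  with coefficient matrices.\<close>

lemma Sym_tensorE:
  assumes "X \<in> Sym_tensor n"
  obtains x where "X = tens n x"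
proof -
  from assms obtain m v \<xi> where v: "\<And>i. i < m \<Longrightarrow> v i \<in> Sym n \<and> \<xi> i \<in> Sym n"
    and X: "X = (\<lambda>z z'. \<Sum>i<(m::nat). tensor (v i) (\<xi> i) z z')"
    by (auto simp: Sym_tensor_def)
  have "X z = tens n (\<lambda>j k. \<Sum>i<m. hom_coeff n (\<xi> i) k * hom_coeff n (v i) j) z" for z
  proof -
    have "X z = (\<lambda>z'. \<Sum>i<m. v i z * hom_poly n (hom_coeff n (\<xi> i)) z')"
      using v by (auto simp: X tensor_def hom_poly_hom_coeff intro!: sum.cong)
    also have "\<dots> = hom_poly n (\<lambda>k. \<Sum>i<m. v i z * hom_coeff n (\<xi> i) k)"
      by (rule hom_poly_sum)
    also have "(\<lambda>k. \<Sum>i<m. v i z * hom_coeff n (\<xi> i) k) =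
        (\<lambda>k. (\<lambda>z. \<Sum>i<m. hom_coeff n (\<xi> i) k * hom_poly n (hom_coeff n (v i)) z) z)"
      using v by (auto simp: hom_poly_hom_coeff mult.commute intro!: sum.cong)
    also have "hom_poly n \<dots> = tens n (\<lambda>j k. \<Sum>i<m. hom_coeff n (\<xi> i) k * hom_coeff n (v i) j) z"
      unfolding tens_def by (rule arg_cong[where f = "hom_poly n"]) (rule ext, rule fun_cong[OF hom_poly_sum])
    finally show ?thesis .
  qed
  then show ?thesis by (intro that) auto
qed

lemma tensor_coeff_tens: "j \<le> n \<Longrightarrow> k \<le> n \<Longrightarrow> tensor_coeff n (tens n x) j k = x j k"
  by (simp add: tensor_coeff_def tens_def hom_coeff_hom_poly)

lemma tens_add: "(\<lambda>z z'. tens n x z z' + tens n y z z') = tens n (\<lambda>j k. x j k + y j k)"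
  unfolding tens_def fun_eq_iff hom_poly_add[symmetric] by (simp add: hom_poly_def sum.distrib distrib_right)

lemma tens_scale: "(\<lambda>z z'. c * tens n x z z') = tens n (\<lambda>j k. c * x j k)"
  unfolding tens_def fun_eq_iff hom_poly_scale[symmetric] by (simp add: hom_poly_def sum_distrib_left mult.assoc)

lemma Sym_tensor_add:
  "X \<in> Sym_tensor n \<Longrightarrow> Y \<in> Sym_tensor n \<Longrightarrow> (\<lambda>z z'. X z z' + Y z z') \<in> Sym_tensor n"
  by (auto elim!: Sym_tensorE simp: tens_add tens_in_Sym_tensor)

lemma Sym_tensor_scale: "X \<in> Sym_tensor n \<Longrightarrow> (\<lambda>z z'. c * X z z') \<in> Sym_tensor n"
  by (auto elim!: Sym_tensorE simp: tens_scale tens_in_Sym_tensor)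

lemma tensor_in_Sym_tensor: "v \<in> Sym n \<Longrightarrow> a \<in> Sym n \<Longrightarrow> tensor v a \<in> Sym_tensor n"
  by (auto simp: Sym_def tensor_hom_poly tens_in_Sym_tensor)

lemma Sym_zero: "(\<lambda>z. 0) \<in> Sym n"
  using Sym_scale[OF hom_poly_in_Sym, of 0] by simp

lemma tensor_zero_left [simp]: "tensor (\<lambda>z. 0) a = (\<lambda>z z'. 0)"
  by (simp add: tensor_def)

lemma Sym_tensor_zero: "(\<lambda>z z'. 0) \<in> Sym_tensor n"
  using tensor_in_Sym_tensor[OF Sym_zero Sym_zero] by simp

lemma tensor_inner_tens:
  "tensor_inner n (tens n x) (tens n y) =
    (\<Sum>j\<le>n. \<Sum>k\<le>n. x j k * cnj (y j k) / (of_nat (n choose j) * of_nat (n choose k)))"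
  by (simp add: tensor_inner_def tensor_coeff_tens)

lemma tensor_inner_add_left:
  assumes "X \<in> Sym_tensor n" "Y \<in> Sym_tensor n" "Z \<in> Sym_tensor n"
  shows "tensor_inner n (\<lambda>z z'. X z z' + Y z z') Z = tensor_inner n X Z + tensor_inner n Y Z"
proof -
  obtain x y z where "X = tens n x" "Y = tens n y" "Z = tens n z"
    using assms by (auto elim!: Sym_tensorE)
  then show ?thesis
    by (simp add: tens_add tensor_inner_tens distrib_right add_divide_distrib sum.distrib)
qed

lemma tensor_inner_scale_left:
  assumes "X \<in> Sym_tensor n" "Z \<in> Sym_tensor n"
  shows "tensor_inner n (\<lambda>z z'. c * X z z') Z = c * tensor_inner n X Z"
proof -
  obtain x z where "X = tens n x" "Z = tens n z"
    using assms by (auto elim!: Sym_tensorE)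
  then show ?thesis
    by (simp add: tens_scale tensor_inner_tens sum_distrib_left mult.assoc)
qed

lemma tensor_inner_cnj: "cnj (tensor_inner n X Y) = tensor_inner n Y X"
  by (simp add: tensor_inner_def mult.commute)

lemma tensor_inner_add_right:
  assumes "X \<in> Sym_tensor n" "Y \<in> Sym_tensor n" "Z \<in> Sym_tensor n"
  shows "tensor_inner n Z (\<lambda>z z'. X z z' + Y z z') = tensor_inner n Z X + tensor_inner n Z Y"
  by (metis tensor_inner_add_left[OF assms] tensor_inner_cnj complex_cnj_add)

lemma tensor_inner_scale_right:
  assumes "X \<in> Sym_tensor n" "Z \<in> Sym_tensor n"
  shows "tensor_inner n Z (\<lambda>z z'. c * X z z') = cnj c * tensor_inner n Z X"
  by (metis tensor_inner_scale_left[OF assms] tensor_inner_cnj complex_cnj_mult)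

lemma tensor_inner_zero [simp]:
  "tensor_inner n (\<lambda>z z'. 0) X = 0" "tensor_inner n X (\<lambda>z z'. 0) = 0"
proof -
  have "tensor_inner n (\<lambda>z z'. 0) Y = 0" for Y
  proof -
    have "tens n (\<lambda>j k. 0) = (\<lambda>z z'. 0)" by (simp add: tens_def hom_poly_def)
    then show ?thesis
      using tensor_coeff_tens[of _ n _ "\<lambda>j k. 0"] by (simp add: tensor_inner_def)
  qed
  then show "tensor_inner n (\<lambda>z z'. 0) X = 0" "tensor_inner n X (\<lambda>z z'. 0) = 0"
    using tensor_inner_cnj[of n "\<lambda>z z'. 0" X] by auto
qed

lemma tensor_inner_self_nonneg: "Re (tensor_inner n X X) \<ge> 0"
proof -
  have *: "a * cnj a / (of_nat m * of_nat k) = of_real ((cmod a)\<^sup>2 / (real m * real k))" for a and m k :: nat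
    by (metis complex_norm_square of_real_divide of_real_of_nat_eq of_real_mult)
  show ?thesis
    unfolding tensor_inner_def Re_sum * by (intro sum_nonneg) auto
qed

lemma tensor_inner_self_real: "tensor_inner n X X = of_real (Re (tensor_inner n X X))"
  using arg_cong[OF tensor_inner_cnj[of n X X], of Im] by (simp add: complex_eq_iff)

text \<open>Expand the nonnegative squared norm of \<open>X - Y\<close>. Both the closure of
  \<open>PW\<close> under addition and Bessel's inequality rest on this.\<close>

lemma tensor_inner_cross_le:
  assumes "X \<in> Sym_tensor n" "Y \<in> Sym_tensor n"
  shows "Re (tensor_inner n X Y) + Re (tensor_inner n Y X) \<le> Re (tensor_inner n X X) + Re (tensor_inner n Y Y)"
proof -
  define W where "W = (\<lambda>z z'. (-1) * Y z z')"
  have W: "W \<in> Sym_tensor n"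
    unfolding W_def using assms(2) by (rule Sym_tensor_scale)
  have "tensor_inner n W Z = - tensor_inner n Y Z" "tensor_inner n Z W = - tensor_inner n Z Y"
    if "Z \<in> Sym_tensor n" for Z
    using tensor_inner_scale_left[OF assms(2) that, of "-1"] tensor_inner_scale_right[OF assms(2) that, of "-1"]
    by (simp_all add: W_def)
  then show ?thesis
    using tensor_inner_self_nonneg[of n "\<lambda>z z'. X z z' + W z z'"] assms W
    by (simp add: tensor_inner_add_left tensor_inner_add_right Sym_tensor_add)
qed

lemma tensor_inner_add_self_le:
  assumes "X \<in> Sym_tensor n" "Y \<in> Sym_tensor n"
  shows "Re (tensor_inner n (\<lambda>z z'. X z z' + Y z z') (\<lambda>z z'. X z z' + Y z z'))
    \<le> 2 * Re (tensor_inner n X X) + 2 * Re (tensor_inner n Y Y)"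
  using tensor_inner_cross_le[OF assms] assms
  by (simp add: tensor_inner_add_left tensor_inner_add_right Sym_tensor_add)

text \<open>The partial inner product of the second tensor factor with \<open>a\<close>.\<close>

definition contract :: "nat \<Rightarrow> cpoly2 \<Rightarrow> cpoly22 \<Rightarrow> cpoly2" where
  "contract n a X = (\<lambda>z. sym_inner n (X z) a)"

lemma contract_tens:
  "contract n (hom_poly n a) (tens n x) = hom_poly n (\<lambda>j. \<Sum>k\<le>n. cnj (a k) / of_nat (n choose k) * x j k)"
  unfolding contract_def tens_def sym_inner_hom_poly hom_poly_sum[symmetric]
  by (simp add: mult.commute)

lemma contract_in_Sym:
  assumes "X \<in> Sym_tensor n" "a \<in> Sym n"
  shows "contract n a X \<in> Sym n"
proof -
  obtain x c where "X = tens n x" "a = hom_poly n c"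
    using assms by (auto elim: Sym_tensorE simp: Sym_def)
  then show ?thesis by (simp add: contract_tens)
qed

lemma Sym_tensor_row: "X \<in> Sym_tensor n \<Longrightarrow> X z \<in> Sym n"
  by (auto elim!: Sym_tensorE simp: tens_def)

lemma contract_tensor: "b \<in> Sym n \<Longrightarrow> contract n a (tensor v b) = (\<lambda>z. v z * sym_inner n b a)"
  by (simp add: contract_def tensor_def sym_inner_scale_left)

lemma contract_add:
  "X \<in> Sym_tensor n \<Longrightarrow> Y \<in> Sym_tensor n \<Longrightarrow>
    contract n a (\<lambda>z z'. X z z' + Y z z') = (\<lambda>z. contract n a X z + contract n a Y z)"
  by (simp add: contract_def sym_inner_add_left Sym_tensor_row)

lemma contract_scale:
  "X \<in> Sym_tensor n \<Longrightarrow> contract n a (\<lambda>z z'. c * X z z') = (\<lambda>z. c * contract n a X z)"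
  by (simp add: contract_def sym_inner_scale_left Sym_tensor_row)

lemma contract_zero [simp]: "contract n a (\<lambda>z z'. 0) = (\<lambda>z. 0)"
  by (simp add: contract_def)

text \<open>Contraction with \<open>a\<close> is the adjoint of tensoring with \<open>a\<close>; on
  coefficients this is a rearrangement of a finite double sum.\<close>

lemma tensor_inner_contract:
  assumes "X \<in> Sym_tensor n" "v \<in> Sym n" "a \<in> Sym n"
  shows "tensor_inner n X (tensor v a) = sym_inner n (contract n a X) v"
proof -
  obtain x c d where "X = tens n x" "a = hom_poly n c" "v = hom_poly n d"
    using assms by (auto elim: Sym_tensorE simp: Sym_def)
  then show ?thesis
    by (simp add: contract_tens tensor_hom_poly tensor_inner_tens sym_inner_hom_poly
        sum_distrib_left sum_divide_distrib mult_ac)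
qed

lemma tensor_inner_tensor:
  assumes "v \<in> Sym n" "a \<in> Sym n" "v' \<in> Sym n" "a' \<in> Sym n"
  shows "tensor_inner n (tensor v a) (tensor v' a') = sym_inner n v v' * sym_inner n a a'"
  using assms sym_inner_scale_left[of v n "sym_inner n a a'" v']
  by (simp add: tensor_inner_contract tensor_in_Sym_tensor contract_tensor mult.commute)

text \<open>\<open>P\<close> is the orthogonal projection of \<open>X\<close> to the tensors with
  second factor \<open>a\<close>. The inner products of \<open>P\<close> with \<open>X\<close> and
  with itself all equal the squared norm of the contraction, so the cross-term bound leaves the
  claim.\<close>

lemma contract_bessel:
  assumes X: "X \<in> Sym_tensor n" and a: "a \<in> Sym n" "sym_inner n a a = 1"
  shows "Re (sym_inner n (contract n a X) (contract n a X)) \<le> Re (tensor_inner n X X)"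
proof -
  define P where "P = tensor (contract n a X) a"
  have c: "contract n a X \<in> Sym n" using X a by (simp add: contract_in_Sym)
  then have P: "P \<in> Sym_tensor n" using a by (simp add: P_def tensor_in_Sym_tensor)
  have XP: "tensor_inner n X P = sym_inner n (contract n a X) (contract n a X)"
    using X a c by (simp add: P_def tensor_inner_contract)
  then have PX: "tensor_inner n P X = sym_inner n (contract n a X) (contract n a X)"
    by (metis tensor_inner_cnj sym_inner_cnj)
  have PP: "tensor_inner n P P = sym_inner n (contract n a X) (contract n a X)"
    using a c by (simp add: P_def tensor_inner_tensor)
  show ?thesis
    using tensor_inner_cross_le[OF X P] by (simp add: XP PX PP)
qed

section \<open>The Hilbert direct sum\<close>

lemma PW_Sym_tensor: "X \<in> PW \<Longrightarrow> X l \<in> Sym_tensor (2 * l)"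
  by (simp add: PW_def)

lemma PW_comparison:
  assumes "X \<in> PW" "\<And>l. Y l \<in> Sym_tensor (2 * l)"
    and "\<And>l. Re (tensor_inner (2 * l) (Y l) (Y l)) \<le> Re (tensor_inner (2 * l) (X l) (X l))"
  shows "Y \<in> PW"
proof -
  have "summable (\<lambda>l. Re (tensor_inner (2 * l) (X l) (X l)))"
    using assms(1) by (simp add: PW_def)
  then have "summable (\<lambda>l. Re (tensor_inner (2 * l) (Y l) (Y l)))"
    by (rule summable_comparison_test') (use assms(3) tensor_inner_self_nonneg in auto)
  then show ?thesis using assms(2) by (simp add: PW_def)
qed

lemma PW_add:
  assumes "X \<in> PW" "Y \<in> PW"
  shows "(\<lambda>l z z'. X l z z' + Y l z z') \<in> PW"
proof -
  have "summable (\<lambda>l. 2 * Re (tensor_inner (2 * l) (X l) (X l)) + 2 * Re (tensor_inner (2 * l) (Y l) (Y l)))"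
    using assms by (auto simp: PW_def intro!: summable_add summable_mult)
  then have "summable (\<lambda>l. Re (tensor_inner (2 * l) (\<lambda>z z'. X l z z' + Y l z z') (\<lambda>z z'. X l z z' + Y l z z')))"
    by (rule summable_comparison_test')
      (use assms tensor_inner_add_self_le tensor_inner_self_nonneg in \<open>auto simp: PW_def\<close>)
  then show ?thesis using assms by (simp add: PW_def Sym_tensor_add)
qed

lemma PW_scale:
  assumes "X \<in> PW"
  shows "(\<lambda>l z z'. c * X l z z') \<in> PW"
proof -
  have "Re (tensor_inner (2 * l) (\<lambda>z z'. c * X l z z') (\<lambda>z z'. c * X l z z')) =
      (cmod c)\<^sup>2 * Re (tensor_inner (2 * l) (X l) (X l))" for l
  proof -
    have "tensor_inner (2 * l) (\<lambda>z z'. c * X l z z') (\<lambda>z z'. c * X l z z') =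
        (c * cnj c) * tensor_inner (2 * l) (X l) (X l)"
      using PW_Sym_tensor[OF assms, of l]
      by (simp add: tensor_inner_scale_left tensor_inner_scale_right Sym_tensor_scale)
    then show ?thesis by (simp flip: complex_norm_square)
  qed
  then show ?thesis
    using assms by (simp add: PW_def Sym_tensor_scale summable_mult)
qed

lemma PW_block: "X \<in> Sym_tensor (2 * l) \<Longrightarrow> block l X \<in> PW"
  unfolding PW_def block_def
  by (auto simp: Sym_tensor_zero intro!: summable_finite[of "{l}"] split: if_splits)

text \<open>All other terms of the series vanish, so testing against a block isolates one component
  without any convergence argument.\<close>

lemma PW_inner_block: "PW_inner X (block l Y) = tensor_inner (2 * l) (X l) Y"
  unfolding PW_inner_def by (subst suminf_finite[of "{l}"]) (auto simp: block_def)

lemma Re_PW_inner_self: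
  assumes "X \<in> PW"
  shows "Re (PW_inner X X) = (\<Sum>l. Re (tensor_inner (2 * l) (X l) (X l)))"
proof -
  have "PW_inner X X = (\<Sum>l. of_real (Re (tensor_inner (2 * l) (X l) (X l))))"
    unfolding PW_inner_def by (subst tensor_inner_self_real) simp
  also have "\<dots> = of_real (\<Sum>l. Re (tensor_inner (2 * l) (X l) (X l)))"
    using assms by (intro suminf_of_real[symmetric]) (simp add: PW_def)
  finally show ?thesis by simp
qed

section \<open>Transfer between sums of lines\<close>

text \<open>The preimage side of \<open>hilbert_sum_line\<close>, kept free of \<Phi> so that the
  arguments run on coefficient sequences.\<close>

definition lines :: "(nat \<Rightarrow> cpoly2) \<Rightarrow> (nat \<Rightarrow> cpoly22) set" where
  "lines a = {X \<in> PW. \<forall>l. \<exists>v\<in>Sym (2 * l). X l = tensor v (a l)}"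

text \<open>For unit vectors this is the sum of the block operators Id \<otimes> |b_l><a_l|; for
  equal families it is the orthogonal projection onto \<open>lines a\<close>.\<close>

definition line_map :: "(nat \<Rightarrow> cpoly2) \<Rightarrow> (nat \<Rightarrow> cpoly2) \<Rightarrow> (nat \<Rightarrow> cpoly22) \<Rightarrow> nat \<Rightarrow> cpoly22" where
  "line_map a b X = (\<lambda>l. tensor (contract (2 * l) (a l) (X l)) (b l))"

definition unit_family :: "(nat \<Rightarrow> cpoly2) \<Rightarrow> bool" where
  "unit_family a \<longleftrightarrow> (\<forall>l. a l \<in> Sym (2 * l) \<and> sym_inner (2 * l) (a l) (a l) = 1)"

lemma unit_familyD:
  assumes "unit_family a" shows "a l \<in> Sym (2 * l)" "sym_inner (2 * l) (a l) (a l) = 1"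
  using assms by (auto simp: unit_family_def)

lemma linesD: "X \<in> lines a \<Longrightarrow> X \<in> PW"
  by (simp add: lines_def)

text \<open>Bessel's inequality in every block provides the convergent majorant, so the map is
  available on all of \<open>PW\<close>.\<close>

lemma line_map_in_lines:
  assumes "X \<in> PW" "unit_family a" "unit_family b"
  shows "line_map a b X \<in> lines b"
proof -
  have c: "contract (2 * l) (a l) (X l) \<in> Sym (2 * l)" for l
    using assms by (simp add: contract_in_Sym PW_Sym_tensor unit_familyD[OF assms(2)] unit_familyD[OF assms(3)])
  have "line_map a b X \<in> PW"
  proof (rule PW_comparison[OF assms(1)])
    fix l
    show "line_map a b X l \<in> Sym_tensor (2 * l)"
      using c assms by (simp add: line_map_def tensor_in_Sym_tensor unit_familyD[OF assms(2)] unit_familyD[OF assms(3)])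
    show "Re (tensor_inner (2 * l) (line_map a b X l) (line_map a b X l)) \<le> Re (tensor_inner (2 * l) (X l) (X l))"
      using c assms contract_bessel[of "X l" "2 * l" "a l"]
      by (simp add: line_map_def tensor_inner_tensor unit_familyD[OF assms(2)] unit_familyD[OF assms(3)] PW_Sym_tensor)
  qed
  then show ?thesis
    using c by (auto simp: lines_def line_map_def)
qed

lemma line_map_in_PW: "X \<in> PW \<Longrightarrow> unit_family a \<Longrightarrow> unit_family b \<Longrightarrow> line_map a b X \<in> PW"
  by (rule linesD[OF line_map_in_lines])

text \<open>The intermediate factor is the inner product of \<open>b l\<close> with itself, which is
  1. Inverses and idempotence of projections are instances.\<close>

lemma line_map_comp:
  assumes "unit_family b"
  shows "line_map b c (line_map a b X) = line_map a c X"
  using assms by (simp add: line_map_def contract_tensor unit_familyD[OF assms])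

lemma line_map_lines:
  assumes "X \<in> lines a" "unit_family a"
  shows "line_map a a X = X"
proof
  fix l
  obtain v where "X l = tensor v (a l)" using assms by (auto simp: lines_def)
  then show "line_map a a X l = X l"
    using assms by (simp add: line_map_def contract_tensor unit_familyD[OF assms(2)])
qed

lemma line_map_add:
  assumes "X \<in> PW" "Y \<in> PW"
  shows "line_map a b (\<lambda>l z z'. X l z z' + Y l z z') = (\<lambda>l z z'. line_map a b X l z z' + line_map a b Y l z z')"
  using assms by (simp add: line_map_def contract_add PW_Sym_tensor tensor_def distrib_right)

lemma line_map_scale:
  assumes "X \<in> PW"
  shows "line_map a b (\<lambda>l z z'. c * X l z z') = (\<lambda>l z z'. c * line_map a b X l z z')"
  using assms by (simp add: line_map_def contract_scale PW_Sym_tensor tensor_def mult.assoc)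

text \<open>The constant sequence only serves to apply the block operator of index \<open>l\<close>
  to a single tensor.\<close>

lemma line_map_block: "line_map a b (block l X) = block l (line_map a b (\<lambda>_. X) l)"
  by (auto simp: line_map_def block_def)

lemma line_map_block_tensor:
  assumes "unit_family a"
  shows "line_map a b (block l (tensor v (a l))) = block l (tensor v (b l))"
  using assms unfolding line_map_block by (simp add: line_map_def contract_tensor unit_familyD[OF assms])

lemma block_tensor_in_lines:
  assumes "unit_family a" "v \<in> Sym (2 * l)"
  shows "block l (tensor v (a l)) \<in> lines a"
proof -
  have "\<exists>w\<in>Sym (2 * m). block l (tensor v (a l)) m = tensor w (a m)" for m
    by (rule bexI[of _ "if m = l then v else (\<lambda>z. 0)"]) (use assms(2) Sym_zero in \<open>auto simp: block_def\<close>)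
  then show ?thesis
    using assms by (simp add: lines_def PW_block tensor_in_Sym_tensor unit_familyD[OF assms(1)])
qed

lemma tensor_inner_line_map:
  assumes "X \<in> PW" "Y \<in> PW" "unit_family a" "unit_family b"
  shows "tensor_inner (2 * l) (line_map a b X l) (line_map a b Y l) =
    sym_inner (2 * l) (contract (2 * l) (a l) (X l)) (contract (2 * l) (a l) (Y l))"
  using assms by (simp add: line_map_def tensor_inner_tensor contract_in_Sym PW_Sym_tensor unit_familyD[OF assms(3)] unit_familyD[OF assms(4)])

lemma tensor_inner_line_map_right:
  assumes "X \<in> PW" "Y \<in> PW" "unit_family a"
  shows "tensor_inner (2 * l) (X l) (line_map a a Y l) =
    sym_inner (2 * l) (contract (2 * l) (a l) (X l)) (contract (2 * l) (a l) (Y l))"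
  using assms by (simp add: line_map_def tensor_inner_contract contract_in_Sym PW_Sym_tensor unit_familyD[OF assms(3)])

lemma PW_inner_line_map:
  assumes "X \<in> lines a" "Y \<in> lines a" "unit_family a" "unit_family b"
  shows "PW_inner (line_map a b X) (line_map a b Y) = PW_inner X Y"
proof -
  have "tensor_inner (2 * l) (line_map a b X l) (line_map a b Y l) = tensor_inner (2 * l) (X l) (Y l)" for l
    using assms tensor_inner_line_map_right[of X Y a l] linesD[OF assms(1)] linesD[OF assms(2)]
    by (simp add: tensor_inner_line_map line_map_lines)
  then show ?thesis by (simp add: PW_inner_def)
qed

text \<open>Pairings with single-block vectors determine every contraction, and an element of
  \<open>lines b\<close> is rebuilt from its contractions with \<open>b\<close>.\<close>

lemma line_map_eqI:
  assumes "X \<in> lines a" "Y \<in> lines b" "unit_family a" "unit_family b"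
    and "\<And>l v. v \<in> Sym (2 * l) \<Longrightarrow>
      PW_inner X (block l (tensor v (a l))) = PW_inner Y (block l (tensor v (b l)))"
  shows "Y = line_map a b X"
proof -
  have X: "X \<in> PW" and Y: "Y \<in> PW" using assms by (auto dest: linesD)
  have "contract (2 * l) (a l) (X l) = contract (2 * l) (b l) (Y l)" for l
  proof (rule sym_inner_eqI)
    fix v assume "v \<in> Sym (2 * l)"
    then show "sym_inner (2 * l) (contract (2 * l) (a l) (X l)) v =
        sym_inner (2 * l) (contract (2 * l) (b l) (Y l)) v"
      using assms(3,4) assms(5)[of v l] X Y
      by (simp add: PW_inner_block tensor_inner_contract PW_Sym_tensor unit_familyD[OF assms(3)] unit_familyD[OF assms(4)])
  qed (use assms X Y in \<open>simp_all add: contract_in_Sym PW_Sym_tensor unit_familyD[OF assms(3)] unit_familyD[OF assms(4)]\<close>)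
  then have "line_map a b X = line_map b b Y"
    by (simp add: line_map_def)
  then show ?thesis using assms by (simp add: line_map_lines)
qed

section \<open>Rotations of sums of lines\<close>

lemma op_tensor_id_so3_rep: "op_tensor_id (so3_rep R) (tensor v a) = tensor (so3_rep R v) a"
  by (simp add: op_tensor_id_def tensor_def so3_rep_def Let_def)

text \<open>Rotations act on the first factor and \<open>line_map\<close> contracts the second.
  Unitarity keeps every block norm, hence square summability.\<close>

lemma rotate_lines:
  assumes "R \<in> SO3" "X \<in> lines a" "unit_family a"
  shows "(\<lambda>l. op_tensor_id (so3_rep R) (X l)) \<in> lines a" (is ?A)
    and "line_map a b (\<lambda>l. op_tensor_id (so3_rep R) (X l)) =
      (\<lambda>l. op_tensor_id (so3_rep R) (line_map a b X l))" (is ?B)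
proof -
  obtain v where v: "\<And>l. v l \<in> Sym (2 * l)" "\<And>l. X l = tensor (v l) (a l)"
  proof -
    have "\<forall>l. \<exists>v. v \<in> Sym (2 * l) \<and> X l = tensor v (a l)"
      using assms(2) by (auto simp: lines_def)
    then show thesis using that by metis
  qed
  have "(\<lambda>l. tensor (so3_rep R (v l)) (a l)) \<in> PW"
    by (rule PW_comparison[OF linesD[OF assms(2)]])
      (use assms v in \<open>auto simp: tensor_in_Sym_tensor tensor_inner_tensor so3_rep_in_Sym so3_rep_unitary unit_familyD[OF assms(3)]\<close>)
  then show ?A
    using assms(1) v by (auto simp: lines_def op_tensor_id_so3_rep intro: so3_rep_in_Sym)
  show ?B
    using assms(3) by (simp add: v op_tensor_id_so3_rep line_map_def contract_tensor unit_familyD[OF assms(3)])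
qed

section \<open>Transport to L^2(SO(3)) along a Peter-Weyl identification\<close>

locale line_transfer =
  fixes \<Phi> :: "(nat \<Rightarrow> cpoly22) \<Rightarrow> l2" and a b :: "nat \<Rightarrow> cpoly2"
  assumes pw: "peter_weyl \<Phi>"
    and unit_a: "unit_family a" and unit_b: "unit_family b"
begin

abbreviation "Ha \<equiv> hilbert_sum_line \<Phi> a"
abbreviation "Hb \<equiv> hilbert_sum_line \<Phi> b"

lemma map_inj: "inj_on \<Phi> PW"
  and map_surj: "\<exists>X\<in>PW. F = \<Phi> X"
  and map_add: "X \<in> PW \<Longrightarrow> Y \<in> PW \<Longrightarrow> \<Phi> (\<lambda>l z z'. X l z z' + Y l z z') = \<Phi> X + \<Phi> Y"
  and map_scale: "X \<in> PW \<Longrightarrow> \<Phi> (\<lambda>l z z'. c * X l z z') = l2_scale c (\<Phi> X)"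
  and map_inner: "X \<in> PW \<Longrightarrow> Y \<in> PW \<Longrightarrow> l2_inner (\<Phi> X) (\<Phi> Y) = PW_inner X Y"
  and map_rotate: "R \<in> SO3 \<Longrightarrow> X \<in> PW \<Longrightarrow>
    \<Phi> (\<lambda>l. op_tensor_id (so3_rep R) (X l)) = left_translate R (\<Phi> X)"
proof -
  have bij: "bij_betw \<Phi> PW UNIV" using pw by (simp add: peter_weyl_def)
  then show "inj_on \<Phi> PW" "\<exists>X\<in>PW. F = \<Phi> X"
    by (auto simp: bij_betw_def image_iff)
qed (use pw in \<open>auto simp: peter_weyl_def\<close>)

lemma hilbert_sum_line_eq: "hilbert_sum_line \<Phi> c = \<Phi> ` lines c"
  by (simp add: hilbert_sum_line_def lines_def)

text \<open>\<open>peter_weyl\<close> speaks of sums and of \<open>l2_scale\<close>, not of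
  subtraction in \<open>l2\<close>; adding the image of \<open>Y\<close> back settles the
  matter.\<close>

lemma map_diff:
  assumes "X \<in> PW" "Y \<in> PW"
  shows "\<Phi> (\<lambda>l z z'. X l z z' + (-1) * Y l z z') = \<Phi> X - \<Phi> Y"
proof -
  have W: "(\<lambda>l z z'. (-1) * Y l z z') \<in> PW" by (rule PW_scale[OF assms(2)])
  have "\<Phi> (\<lambda>l z z'. X l z z' + (-1) * Y l z z') + \<Phi> Y =
      \<Phi> (\<lambda>l z z'. (X l z z' + (-1) * Y l z z') + Y l z z')"
    by (rule map_add[symmetric, OF PW_add[OF assms(1) W] assms(2)])
  then show ?thesis by (simp add: eq_diff_eq)
qed

text \<open>The image is some \<open>Y\<close> in \<open>lines b\<close>. Preservation of inner
  products with the prescribed block vectors gives the hypothesis of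
  \<open>line_map_eqI\<close>.\<close>

lemma transform_unique:
  assumes T: "unitary_between Ha Hb T"
    and blocks: "\<And>l v. v \<in> Sym (2 * l) \<Longrightarrow>
      T (\<Phi> (block l (tensor v (a l)))) = \<Phi> (block l (tensor v (b l)))"
    and X: "X \<in> lines a"
  shows "T (\<Phi> X) = \<Phi> (line_map a b X)"
proof -
  have "T (\<Phi> X) \<in> \<Phi> ` lines b"
    using T X by (auto simp: unitary_between_def bij_betw_def hilbert_sum_line_eq)
  then obtain Y where Y: "Y \<in> lines b" "T (\<Phi> X) = \<Phi> Y" by auto
  have "PW_inner X (block l (tensor v (a l))) = PW_inner Y (block l (tensor v (b l)))"
    if v: "v \<in> Sym (2 * l)" for l v
  proof -
    let ?A = "block l (tensor v (a l))" and ?B = "block l (tensor v (b l))"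
    have A: "?A \<in> lines a" and B: "?B \<in> lines b"
      using v by (simp_all add: block_tensor_in_lines unit_a unit_b)
    have "l2_inner (T (\<Phi> X)) (T (\<Phi> ?A)) = l2_inner (\<Phi> X) (\<Phi> ?A)"
      using T X A by (auto simp: unitary_between_def hilbert_sum_line_eq)
    then show ?thesis
      using linesD[OF X] linesD[OF Y(1)] linesD[OF A] linesD[OF B] by (simp add: blocks[OF v] Y map_inner)
  qed
  then have "Y = line_map a b X"
    by (rule line_map_eqI[OF X Y(1) unit_a unit_b])
  with Y show ?thesis by simp
qed

section \<open>Properties of a map given by \<open>line_map\<close> on the sum of lines\<close>

context
  fixes T assumes T: "\<And>X. X \<in> lines a \<Longrightarrow> T (\<Phi> X) = \<Phi> (line_map a b X)"
begin

lemma transform_unitary: "unitary_between Ha Hb T"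
  unfolding unitary_between_def hilbert_sum_line_eq
proof (intro conjI)
  show "clinear_on (\<Phi> ` lines a) T"
    unfolding clinear_on_def
  proof (intro conjI ballI allI; clarify)
    fix X assume X: "X \<in> lines a"
    note XP = linesD[OF X]
    show "T (l2_scale c (\<Phi> X)) = l2_scale c (T (\<Phi> X))" for c
    proof -
      let ?Z = "\<lambda>l z z'. c * X l z z'"
      have Z: "?Z \<in> PW" by (rule PW_scale[OF XP])
      \<comment> \<open>Being fixed by the projection is a linear condition and implies membership
        in \<open>lines a\<close>.\<close>
      have "line_map a a ?Z = ?Z"
        by (simp add: line_map_scale[OF XP] line_map_lines[OF X unit_a])
      then have "?Z \<in> lines a"
        by (metis line_map_in_lines[OF Z unit_a unit_a])
      then show ?thesis
        by (simp add: map_scale[symmetric] XP T X line_map_scale line_map_in_PW unit_a unit_b)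
    qed
    fix Y assume Y: "Y \<in> lines a"
    note YP = linesD[OF Y]
    show "T (\<Phi> X + \<Phi> Y) = T (\<Phi> X) + T (\<Phi> Y)"
    proof -
      let ?Z = "\<lambda>l z z'. X l z z' + Y l z z'"
      have Z: "?Z \<in> PW" by (rule PW_add[OF XP YP])
      have "line_map a a ?Z = ?Z"
        by (simp add: line_map_add[OF XP YP] line_map_lines[OF X unit_a] line_map_lines[OF Y unit_a])
      then have "?Z \<in> lines a"
        by (metis line_map_in_lines[OF Z unit_a unit_a])
      then show ?thesis
        by (simp add: map_add[symmetric] XP YP T X Y line_map_add line_map_in_PW unit_a unit_b)
    qed
  qed
  show "bij_betw T (\<Phi> ` lines a) (\<Phi> ` lines b)"
    unfolding bij_betw_def
  proof
    show "inj_on T (\<Phi> ` lines a)"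
    proof (rule inj_onI, clarify)
      fix X Y assume X: "X \<in> lines a" and Y: "Y \<in> lines a" and eq: "T (\<Phi> X) = T (\<Phi> Y)"
      have "line_map a b X = line_map a b Y"
        using map_inj eq line_map_in_PW[OF linesD[OF X] unit_a unit_b] line_map_in_PW[OF linesD[OF Y] unit_a unit_b]
        by (simp add: T X Y inj_on_eq_iff)
      \<comment> \<open>\<open>line_map b a\<close> is a left inverse on \<open>lines a\<close>; it
        also provides the preimages for surjectivity.\<close>
      then have "line_map b a (line_map a b X) = line_map b a (line_map a b Y)" by simp
      then show "\<Phi> X = \<Phi> Y"
        by (simp add: line_map_comp[OF unit_b] line_map_lines[OF X unit_a] line_map_lines[OF Y unit_a])
    qed
    show "T ` \<Phi> ` lines a = \<Phi> ` lines b"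
    proof (intro equalityI subsetI; clarify)
      fix X assume X: "X \<in> lines a"
      show "T (\<Phi> X) \<in> \<Phi> ` lines b"
        by (simp add: T X line_map_in_lines[OF linesD[OF X] unit_a unit_b])
    next
      fix Y assume Y: "Y \<in> lines b"
      let ?X = "line_map b a Y"
      have X: "?X \<in> lines a" by (rule line_map_in_lines[OF linesD[OF Y] unit_b unit_a])
      have "T (\<Phi> ?X) = \<Phi> Y"
        by (simp add: T X line_map_comp[OF unit_a] line_map_lines[OF Y unit_b])
      then show "\<Phi> Y \<in> T ` \<Phi> ` lines a" using X by (metis image_eqI)
    qed
  qed
  show "\<forall>F\<in>\<Phi> ` lines a. \<forall>G\<in>\<Phi> ` lines a. l2_inner (T F) (T G) = l2_inner F G"
  proof (intro ballI; clarify)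
    fix X Y assume X: "X \<in> lines a" and Y: "Y \<in> lines a"
    note P = linesD[OF X] linesD[OF Y]
    show "l2_inner (T (\<Phi> X)) (T (\<Phi> Y)) = l2_inner (\<Phi> X) (\<Phi> Y)"
      by (simp add: T X Y P map_inner line_map_in_PW unit_a unit_b PW_inner_line_map[OF X Y unit_a unit_b])
  qed
qed

lemma transform_equivariant: "equivariant_on Ha T"
  unfolding equivariant_on_def hilbert_sum_line_eq
proof (intro ballI; clarify)
  fix R X assume R: "R \<in> SO3" and X: "X \<in> lines a"
  note XP = linesD[OF X] and rot = rotate_lines[OF R X unit_a]
  have "T (left_translate R (\<Phi> X)) = left_translate R (T (\<Phi> X))"
    by (simp add: map_rotate[symmetric] R XP T X rot line_map_in_PW unit_a unit_b)
  then show "left_translate R (\<Phi> X) \<in> \<Phi> ` lines a \<and>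
      T (left_translate R (\<Phi> X)) = left_translate R (T (\<Phi> X))"
    using rot(1) by (simp add: map_rotate[symmetric] R XP)
qed

lemma transform_block:
  "v \<in> Sym (2 * l) \<Longrightarrow> T (\<Phi> (block l (tensor v (a l)))) = \<Phi> (block l (tensor v (b l)))"
  by (simp add: T block_tensor_in_lines unit_a line_map_block_tensor)

text \<open>The description in \<open>zero_extension\<close> denotes the image of
  \<open>line_map a a X\<close>, the orthogonal projection; applying \<open>T\<close> then composes
  two line maps.\<close>

lemma zero_extension_eq:
  assumes X: "X \<in> PW"
  shows "zero_extension Ha T (\<Phi> X) = \<Phi> (line_map a b X)"
proof -
  let ?P = "line_map a a X"
  have P: "?P \<in> lines a" "?P \<in> PW" by (simp_all add: line_map_in_lines line_map_in_PW X unit_a)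
  have diff_inner: "l2_inner (\<Phi> X - \<Phi> Q) (\<Phi> Y) = 0 \<longleftrightarrow> PW_inner (\<lambda>l z z'. X l z z' + (-1) * Q l z z') Y = 0"
    if "Q \<in> PW" "Y \<in> PW" for Q Y
    using PW_add[OF X PW_scale[OF that(1), of "-1"]] that
    by (simp only: map_diff[OF X that(1), symmetric] map_inner)
  \<comment> \<open>Subtraction takes place within one block, so no infinite series has to be
    split.\<close>
  have diff_term: "tensor_inner (2 * l) (\<lambda>z z'. X l z z' + (-1) * Q l z z') (Y l) =
      tensor_inner (2 * l) (X l) (Y l) - tensor_inner (2 * l) (Q l) (Y l)"
    if "Q \<in> PW" "Y \<in> PW" for Q Y l
    using that X tensor_inner_add_left[OF PW_Sym_tensor[OF X] Sym_tensor_scale[OF PW_Sym_tensor[OF that(1)]]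
        PW_Sym_tensor[OF that(2)], of l "-1"]
    by (simp only: tensor_inner_scale_left PW_Sym_tensor) simp
  have "(THE Q. Q \<in> Ha \<and> \<Phi> X - Q \<in> orth_compl Ha) = \<Phi> ?P"
  proof (rule the_equality)
    have "l2_inner (\<Phi> X - \<Phi> ?P) (\<Phi> Y) = 0" if Y: "Y \<in> lines a" for Y
    proof -
      have YP: "Y \<in> PW" by (rule linesD[OF Y])
      \<comment> \<open>Both sides are the inner product of the contractions of \<open>X\<close> and
        \<open>Y\<close>.\<close>
      have "tensor_inner (2 * l) (X l) (Y l) = tensor_inner (2 * l) (?P l) (Y l)" for l
        using tensor_inner_line_map_right[OF X YP unit_a, of l] tensor_inner_line_map_right[OF P(2) YP unit_a, of l]
          tensor_inner_line_map[OF X YP unit_a unit_a, of l]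
        by (simp add: line_map_lines[OF Y unit_a])
      then show ?thesis
        unfolding diff_inner[OF P(2) YP] PW_inner_def diff_term[OF P(2) YP] by simp
    qed
    then show "\<Phi> ?P \<in> Ha \<and> \<Phi> X - \<Phi> ?P \<in> orth_compl Ha"
      using P by (auto simp: hilbert_sum_line_eq orth_compl_def)
  next
    fix Q' assume "Q' \<in> Ha \<and> \<Phi> X - Q' \<in> orth_compl Ha"
    then obtain Q where Q: "Q \<in> lines a" "Q' = \<Phi> Q"
      and orth: "\<And>Y. Y \<in> lines a \<Longrightarrow> l2_inner (\<Phi> X - \<Phi> Q) (\<Phi> Y) = 0"
      by (auto simp: hilbert_sum_line_eq orth_compl_def)
    have QP: "Q \<in> PW" by (rule linesD[OF Q(1)])
    \<comment> \<open>Two candidates for the projection have the same pairings with all block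
      vectors of \<open>lines a\<close>, which determine them.\<close>
    have "Q = line_map a a ?P"
    proof (rule line_map_eqI[OF P(1) Q(1) unit_a unit_a])
      fix l v assume v: "v \<in> Sym (2 * l)"
      let ?Y = "block l (tensor v (a l))"
      have Y: "?Y \<in> lines a" by (rule block_tensor_in_lines[OF unit_a v])
      note YP = linesD[OF Y]
      have "tensor_inner (2 * l) (X l) (?Y l) = tensor_inner (2 * l) (Q l) (?Y l)"
        using orth[OF Y] diff_term[OF QP YP, of l]
        unfolding diff_inner[OF QP YP] PW_inner_block by (simp add: block_def)
      moreover have "tensor_inner (2 * l) (X l) (?Y l) = tensor_inner (2 * l) (?P l) (?Y l)"
        using tensor_inner_line_map_right[OF X YP unit_a, of l]
          tensor_inner_line_map[OF X YP unit_a unit_a, of l]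
        by (simp add: line_map_lines[OF Y unit_a])
      ultimately show "PW_inner ?P ?Y = PW_inner Q ?Y"
        by (simp add: PW_inner_block) (simp add: block_def)
    qed
    then show "Q' = \<Phi> ?P"
      by (simp add: Q(2) line_map_lines[OF P(1) unit_a])
  qed
  then show ?thesis
    by (simp add: zero_extension_def T P line_map_comp[OF unit_a])
qed

lemma zero_extension_block:
  assumes "X \<in> Sym_tensor (2 * l)"
  shows "zero_extension Ha T (\<Phi> (block l X)) =
    \<Phi> (block l (id_tensor_op (rank_one (2 * l) (b l) (a l)) X))"
proof -
  have "line_map a b (\<lambda>_. X) l = id_tensor_op (rank_one (2 * l) (b l) (a l)) X"
    by (simp add: line_map_def id_tensor_op_def rank_one_def tensor_def contract_def)
  then show ?thesis
    by (simp add: zero_extension_eq PW_block assms line_map_block)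
qed

lemma zero_extension_partial_isometry: "partial_isometry (zero_extension Ha T)"
proof -
  let ?E = "zero_extension Ha T"
  have zero: "\<Phi> (\<lambda>l z z'. 0) = 0"
    using map_diff[of "\<lambda>l z z'. 0" "\<lambda>l z z'. 0"] PW_block[OF Sym_tensor_zero, of 0]
    by (simp add: block_def)
  have linear: "clinear_on UNIV ?E"
    unfolding clinear_on_def
  proof (intro conjI ballI allI)
    fix F G c
    obtain X Y where X: "X \<in> PW" "F = \<Phi> X" and Y: "Y \<in> PW" "G = \<Phi> Y" using map_surj by metis
    show "?E (F + G) = ?E F + ?E G"
      by (simp add: X Y map_add[symmetric] zero_extension_eq PW_add line_map_add line_map_in_PW unit_a unit_b)
    show "?E (l2_scale c F) = l2_scale c (?E F)"
      by (simp add: X map_scale[symmetric] zero_extension_eq PW_scale line_map_scale line_map_in_PW unit_a unit_b)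
  qed
  have contraction: "l2_norm (?E F) \<le> 1 * l2_norm F" for F
  proof -
    obtain X where X: "X \<in> PW" "F = \<Phi> X" using map_surj by metis
    have L: "line_map a b X \<in> PW" by (rule line_map_in_PW[OF X(1) unit_a unit_b])
    have "Re (tensor_inner (2 * l) (line_map a b X l) (line_map a b X l)) \<le> Re (tensor_inner (2 * l) (X l) (X l))" for l
      using contract_bessel[OF PW_Sym_tensor[OF X(1)] unit_familyD[OF unit_a]]
      by (simp add: tensor_inner_line_map[OF X(1) X(1) unit_a unit_b])
    then have "Re (PW_inner (line_map a b X) (line_map a b X)) \<le> Re (PW_inner X X)"
      using X(1) L by (simp add: Re_PW_inner_self suminf_le PW_def)
    then show ?thesis
      by (simp add: l2_norm_def X zero_extension_eq map_inner L)
  qed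
  have isometric: "l2_norm (?E F) = l2_norm F" if F: "F \<in> orth_compl {G. ?E G = 0}" for F
  proof -
    obtain X where X: "X \<in> PW" "F = \<Phi> X" using map_surj by metis
    let ?P = "line_map a a X"
    have L: "line_map a b X \<in> PW" and P: "?P \<in> PW"
      by (simp_all add: line_map_in_PW X unit_a unit_b)
    have "tensor_inner (2 * l) (line_map a b X l) (line_map a b X l) = tensor_inner (2 * l) (X l) (X l)" for l
    proof -
      \<comment> \<open>The part of \<open>X l\<close> orthogonal to the line spans a vector of the
        kernel. Orthogonality of \<open>F\<close> to it says that the squared norm of
        \<open>X l\<close> is its inner product with the projection, which is the squared norm of
        the image block.\<close>
      define Z where "Z = (\<lambda>z z'. X l z z' + (-1) * ?P l z z')"
      have Xl: "X l \<in> Sym_tensor (2 * l)" and Pl: "?P l \<in> Sym_tensor (2 * l)"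
        by (simp_all add: PW_Sym_tensor X P)
      have Pl': "(\<lambda>z z'. (-1) * ?P l z z') \<in> Sym_tensor (2 * l)" by (rule Sym_tensor_scale[OF Pl])
      have Z: "Z \<in> Sym_tensor (2 * l)"
        unfolding Z_def by (rule Sym_tensor_add[OF Xl Pl'])
      have "contract (2 * l) (a l) Z = (\<lambda>z. contract (2 * l) (a l) (X l) z + (-1) * contract (2 * l) (a l) (?P l) z)"
        unfolding Z_def contract_add[OF Xl Pl'] contract_scale[OF Pl] ..
      also have "\<dots> = (\<lambda>z. 0)"
        by (simp add: line_map_def contract_tensor unit_familyD[OF unit_a])
      finally have "line_map a b (block l Z) = (\<lambda>l z z'. 0)"
        unfolding line_map_block by (simp add: line_map_def block_def)
      then have "?E (\<Phi> (block l Z)) = 0"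
        by (simp add: zero_extension_eq PW_block Z zero)
      then have "l2_inner (\<Phi> X) (\<Phi> (block l Z)) = 0"
        using F X by (simp add: orth_compl_def)
      then have "tensor_inner (2 * l) (X l) Z = 0"
        by (simp add: map_inner X PW_block Z PW_inner_block)
      moreover have "tensor_inner (2 * l) (X l) Z = tensor_inner (2 * l) (X l) (X l) - tensor_inner (2 * l) (X l) (?P l)"
        unfolding Z_def tensor_inner_add_right[OF Xl Pl' Xl] tensor_inner_scale_right[OF Pl Xl] by simp
      ultimately show ?thesis
        by (simp add: tensor_inner_line_map[OF X(1) X(1) unit_a unit_b] tensor_inner_line_map_right[OF X(1) X(1) unit_a])
    qed
    then have "PW_inner (line_map a b X) (line_map a b X) = PW_inner X X"
      by (simp add: PW_inner_def)
    then show ?thesis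
      by (simp add: l2_norm_def X zero_extension_eq map_inner L)
  qed
  show ?thesis
    unfolding partial_isometry_def using linear contraction isometric by blast
qed

end

end

section \<open>Normalization of the vectors \<open>u_vec\<close> and \<open>w_vec\<close>\<close>

lemma normalized_in_Sym: "p \<in> Sym n \<Longrightarrow> normalized n p \<in> Sym n"
  using Sym_scale[of p n "1 / of_real (sym_norm n p)"] by (simp add: normalized_def)

lemma sym_inner_normalized:
  assumes "p \<in> Sym n" "sym_norm n p \<noteq> 0"
  shows "sym_inner n (normalized n p) (normalized n p) = 1"
proof -
  have "normalized n p = (\<lambda>z. of_real (1 / sym_norm n p) * p z)"
    by (simp add: normalized_def)
  then have "sym_inner n (normalized n p) (normalized n p) =
      of_real (1 / sym_norm n p) * (cnj (of_real (1 / sym_norm n p)) * sym_inner n p p)"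
    using assms(1) by (simp only: sym_inner_scale_left sym_inner_scale_right Sym_scale)
  then show ?thesis
    using assms(2) by (simp add: sym_inner_self power2_eq_square)
qed

text \<open>Norm zero annihilates all coefficients, so one nonzero value certifies that
  normalization is legitimate. For both families the point (1, 0) serves, with value 1.\<close>

lemma sym_norm_nonzero:
  assumes "p \<in> Sym n" "p z \<noteq> 0"
  shows "sym_norm n p \<noteq> 0"
proof
  assume "sym_norm n p = 0"
  then have "Re (sym_inner n p p) = 0" by (simp add: sym_inner_self)
  then have "\<forall>k\<in>{..n}. (cmod (hom_coeff n p k))\<^sup>2 / (n choose k) = 0"
    unfolding Re_sym_inner_self by (subst (asm) sum_nonneg_eq_0_iff) auto
  then have "hom_poly n (hom_coeff n p) z = 0"
    by (auto simp: hom_poly_def intro!: sum.neutral)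
  then show False using assms by (simp add: hom_poly_hom_coeff)
qed

lemma u_vec_in_Sym: "u_vec l \<in> Sym (2 * l)"
  using mon_in_Sym[of 0 "2 * l"] by (simp add: mon_def u_vec_def)

lemma w_vec_in_Sym: "w_vec \<tau> l \<in> Sym (2 * l)"
proof -
  have "(\<lambda>z. (z $ 1)\<^sup>2 + (z $ 2)\<^sup>2 + 2 * of_real (coth \<tau>) * (z $ 1) * (z $ 2)) =
      hom_poly 2 (\<lambda>k. if k = 1 then 2 * of_real (coth \<tau>) else 1)"
    by (simp add: hom_poly_def mon_def fun_eq_iff numeral_2_eq_2)
  then have "(\<lambda>z. (z $ 1)\<^sup>2 + (z $ 2)\<^sup>2 + 2 * of_real (coth \<tau>) * (z $ 1) * (z $ 2)) \<in> Sym 2"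
    by (simp only: hom_poly_in_Sym)
  then show ?thesis
    unfolding w_vec_def by (rule Sym_power)
qed

lemma unit_family_normalized:
  assumes "\<And>l. p l \<in> Sym (2 * l)" "\<And>l. p l (vector [1, 0]) = 1"
  shows "unit_family (\<lambda>l. normalized (2 * l) (p l))"
  using assms sym_norm_nonzero[OF assms(1), of _ "vector [1, 0]"]
  by (simp add: unit_family_def normalized_in_Sym sym_inner_normalized)

text \<open>The nonzero scalar is absorbed by the first tensor factor. This reconciles the Hardy
  spaces, defined by unnormalized vectors, with the normalized ones in the transform.\<close>

lemma lines_normalized:
  assumes "\<And>l. p l \<in> Sym (2 * l)" "\<And>l. p l (vector [1, 0]) = 1"
  shows "lines (\<lambda>l. normalized (2 * l) (p l)) = lines p"
proof -
  have nz: "sym_norm (2 * l) (p l) \<noteq> 0" for l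
    using assms by (intro sym_norm_nonzero[of _ _ "vector [1, 0]"]) simp_all
  have "(\<exists>v\<in>Sym (2 * l). X = tensor v (normalized (2 * l) (p l))) \<longleftrightarrow> (\<exists>v\<in>Sym (2 * l). X = tensor v (p l))"
    (is "?L \<longleftrightarrow> ?R") for X l
  proof
    assume ?L
    then obtain v where v: "v \<in> Sym (2 * l)" "X = tensor v (normalized (2 * l) (p l))" by blast
    show ?R
      by (rule bexI[OF _ Sym_scale[OF v(1), of "of_real (1 / sym_norm (2 * l) (p l))"]])
        (simp add: v(2) tensor_def normalized_def)
  next
    assume ?R
    then obtain v where v: "v \<in> Sym (2 * l)" "X = tensor v (p l)" by blast
    show ?L
      by (rule bexI[OF _ Sym_scale[OF v(1), of "of_real (sym_norm (2 * l) (p l))"]])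
        (simp add: v(2) tensor_def normalized_def nz)
  qed
  then show ?thesis by (simp add: lines_def)
qed

theorem theorem1p2:
  fixes \<Phi> :: "(nat \<Rightarrow> cpoly22) \<Rightarrow> l2" and \<tau> :: real
  assumes "peter_weyl \<Phi>" and "\<tau> > 0"
  shows "(\<exists>!T. T \<in> extensional (hardy_M \<Phi> \<tau>) \<and> is_transform \<Phi> \<tau> T) \<and>
    (\<forall>T. is_transform \<Phi> \<tau> T \<longrightarrow>
       (let E = zero_extension (hardy_M \<Phi> \<tau>) T in
         partial_isometry E \<and>
         (\<forall>l. \<forall>X\<in>Sym_tensor (2 * l).
            E (\<Phi> (block l X)) =
            \<Phi> (block l (id_tensor_op
                 (rank_one (2 * l) (normalized (2 * l) (u_vec l))
                                   (normalized (2 * l) (w_vec \<tau> l))) X)))))"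
proof -
  define a where "a = (\<lambda>l. normalized (2 * l) (w_vec \<tau> l))"
  define b where "b = (\<lambda>l. normalized (2 * l) (u_vec l))"
  have w1: "w_vec \<tau> l (vector [1, 0]) = 1" and u1: "u_vec l (vector [1, 0]) = 1" for l
    by (simp_all add: w_vec_def u_vec_def)
  interpret line_transfer \<Phi> a b
    using assms(1) unit_family_normalized[OF w_vec_in_Sym w1] unit_family_normalized[OF u_vec_in_Sym u1]
    by unfold_locales (simp_all add: a_def b_def)
  have M: "hardy_M \<Phi> \<tau> = Ha" and Y: "hardy_Y \<Phi> = Hb"
    unfolding hardy_M_def hardy_Y_def hilbert_sum_line_eq a_def b_def
    by (simp_all add: lines_normalized[OF w_vec_in_Sym w1] lines_normalized[OF u_vec_in_Sym u1])
  \<comment> \<open>All requirements collapse to one explicit formula, from which existence,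
    uniqueness and the extension are read off.\<close>
  have char: "is_transform \<Phi> \<tau> T \<longleftrightarrow> (\<forall>X\<in>lines a. T (\<Phi> X) = \<Phi> (line_map a b X))" for T
  proof
    assume "is_transform \<Phi> \<tau> T"
    then show "\<forall>X\<in>lines a. T (\<Phi> X) = \<Phi> (line_map a b X)"
      by (auto simp: is_transform_def M Y a_def[symmetric] b_def[symmetric] 
          fun_cong[OF a_def, symmetric] fun_cong[OF b_def, symmetric] intro!: transform_unique)
  next
    assume T: "\<forall>X\<in>lines a. T (\<Phi> X) = \<Phi> (line_map a b X)"
    show "is_transform \<Phi> \<tau> T"
      using transform_unitary[of T] transform_equivariant[of T] transform_block[of T] T
      by (simp add: is_transform_def M Y a_def b_def)
  qed
  \<comment> \<open>\<open>inv_into PW \<Phi>\<close> recovers the Peter-Weyl components.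
    Restriction fixes the values outside the Hardy space, so that uniqueness becomes equality of
    total functions.\<close>
  define T0 where "T0 = restrict (\<lambda>F. \<Phi> (line_map a b (inv_into PW \<Phi> F))) Ha"
  have T0: "T0 (\<Phi> X) = \<Phi> (line_map a b X)" if "X \<in> lines a" for X
    using that map_inj by (simp add: T0_def hilbert_sum_line_eq linesD)
  have "\<exists>!T. T \<in> extensional (hardy_M \<Phi> \<tau>) \<and> is_transform \<Phi> \<tau> T"
  proof (rule ex1I)
    show "T0 \<in> extensional (hardy_M \<Phi> \<tau>) \<and> is_transform \<Phi> \<tau> T0"
      using T0 by (simp add: char M) (simp add: T0_def)
    fix T assume T: "T \<in> extensional (hardy_M \<Phi> \<tau>) \<and> is_transform \<Phi> \<tau> T"
    show "T = T0"
    proof (rule extensionalityI)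
      show "T \<in> extensional Ha" using T M by simp
      show "T0 \<in> extensional Ha" by (simp add: T0_def)
      show "T F = T0 F" if "F \<in> Ha" for F
        using that T T0 by (auto simp: hilbert_sum_line_eq char)
    qed
  qed
  moreover have "partial_isometry (zero_extension Ha T)"
    "\<forall>l. \<forall>X\<in>Sym_tensor (2 * l). zero_extension Ha T (\<Phi> (block l X)) =
      \<Phi> (block l (id_tensor_op (rank_one (2 * l) (b l) (a l)) X))"
    if "is_transform \<Phi> \<tau> T" for T
    using that zero_extension_partial_isometry[of T] zero_extension_block[of T] by (auto simp: char)
  ultimately show ?thesis
    by (simp add: M Let_def a_def b_def)
qed

end
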